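(* Let $k$ be a field of characteristic $0$ and let $H$ be a connected graded Hopf algebra over $k$ of finite Gelfand-Kirillov dimension $d$. Then $H$ is an iterated Hopf Ore extension of $k$ (IHOE). More precisely, there is a finite sequence $z_1,\ldots,z_d$ of homogeneous elements of $H$ of positive degrees such that $$H=k[z_1][z_2;\delta_2]\cdots[z_d;\delta_d]$$ and $$\Delta_H(z_r)\in 1\otimes z_r+z_r\otimes 1+\sum_{i,j>0,\ i+j=\deg(z_r)}(H^{\leq r-1})_i\otimes(H^{\leq r-1})_j,\qquad r=1,\ldots,d,$$ where $H^{\leq 0}=k$, $H^{\leq i}$ is the subalgebra of $H$ generated by $z_1,\ldots,z_i$ for $i=1,\ldots,d$, and $\delta_i$ is a derivation of $H^{\leq i-1}$ for $i=2,\ldots,d$ (so that $H^{\leq 1}=k[z_1]$ and $H^{\leq i}=H^{\leq i-1}[z_i;\delta_i]$ for $2\le i\le d$). In particular, $H^{\leq 0},H^{\leq 1},\ldots,H^{\leq d}$ are all graded Hopf subalgebras of $H$.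
   Context: All vector spaces, algebras, coalgebras and tensor products are over $k$. A graded Hopf algebra is a Hopf algebra $H$ equipped with a grading $H=\bigoplus_{n\geq 0}H_n$ such that $H$ is simultaneously a graded algebra and a graded coalgebra, and the antipode preserves the grading. It is connected if $H_0$ is one-dimensional. $\Delta_H$ is the comultiplication of $H$; for a homogeneous subalgebra $B$ of $H$, $B_i=B\cap H_i$. A Hopf algebra $H$ is called an iterated Hopf Ore extension of $k$ (IHOE) if there is a chain of Hopf subalgebras $k=H^0\subset H^1\subset\cdots\subset H^n=H$ with each of the extensions $H^i\subset H^{i+1}$ being an Ore extension as algebras, i.e. $H^{i+1}=H^i[x;\sigma,\delta]$ for some algebra automorphism $\sigma$ and $\sigma$-derivation $\delta$ of $H^i$. The notation $A[z;\delta]$ denotes the Ore extension with trivial automorphism: it is a free left $A$-module with basis $1,z,z^2,\ldots$ and $za=az+\delta(a)$ for $a\in A$; $k[z_1]$ is the polynomial algebra in $z_1$. *)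

theory Defs
  imports
    Complex_Main
    "HOL-Library.Poly_Mapping"
    "HOL-Library.Extended_Real"
    "HOL-Library.Liminf_Limsup"
    "HOL-Computational_Algebra.Polynomial"
begin

section \<open>Free vector spaces\<close>

text \<open>
  The type \<^typ>\<open>'x \<Rightarrow>\<^sub>0 'k\<close> serves as the vector space over \<^typ>\<open>'k\<close> with basis \<^typ>\<open>'x\<close>; the
  basis vector belonging to \<open>x\<close> is \<open>Poly_Mapping.single x 1\<close>.
\<close>

definition free_scale :: "'k::field \<Rightarrow> ('x \<Rightarrow>\<^sub>0 'k) \<Rightarrow> ('x \<Rightarrow>\<^sub>0 'k)" where
  "free_scale c f = Poly_Mapping.map ((*) c) f"

lemma lookup_free_scale [simp]:
  "Poly_Mapping.lookup (free_scale c f) x = c * Poly_Mapping.lookup f x"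
  by (simp add: free_scale_def Poly_Mapping.map.rep_eq when_def)

global_interpretation free: vector_space "free_scale :: 'k::field \<Rightarrow> ('x \<Rightarrow>\<^sub>0 'k) \<Rightarrow> ('x \<Rightarrow>\<^sub>0 'k)"
  by unfold_locales
    (simp_all add: poly_mapping_eq_iff fun_eq_iff lookup_add algebra_simps)

text \<open>The linear extension of a map \<open>g\<close> given on the basis.\<close>

definition free_lift ::
  "('k::field \<Rightarrow> 'v::ab_group_add \<Rightarrow> 'v) \<Rightarrow> ('x \<Rightarrow> 'v) \<Rightarrow> ('x \<Rightarrow>\<^sub>0 'k) \<Rightarrow> 'v" where
  "free_lift s g f = (\<Sum>x\<in>Poly_Mapping.keys f. s (Poly_Mapping.lookup f x) (g x))"

context vector_space
begin

lemma free_lift_superset: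
  assumes "finite A" "Poly_Mapping.keys f \<subseteq> A"
  shows "free_lift scale g f = (\<Sum>x\<in>A. scale (Poly_Mapping.lookup f x) (g x))"
  unfolding free_lift_def
  by (rule sum.mono_neutral_left) (use assms in \<open>auto simp: in_keys_iff\<close>)

lemma free_lift_add: "free_lift scale g (f + f') = free_lift scale g f + free_lift scale g f'"
proof -
  let ?A = "Poly_Mapping.keys f \<union> Poly_Mapping.keys f'"
  have "Poly_Mapping.keys (f + f') \<subseteq> ?A" by (rule Poly_Mapping.keys_add)
  then show ?thesis
    by (simp add: free_lift_superset[of ?A] lookup_add scale_left_distrib sum.distrib)
qed

lemma free_lift_scale: "free_lift scale g (free_scale c f) = scale c (free_lift scale g f)"
proof -
  have "Poly_Mapping.keys (free_scale c f) \<subseteq> Poly_Mapping.keys f"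
    by (auto simp: in_keys_iff)
  then show ?thesis
    by (simp add: free_lift_superset[of "Poly_Mapping.keys f"] scale_sum_right)
qed

lemma free_lift_diff: "free_lift scale g (f - f') = free_lift scale g f - free_lift scale g f'"
  using free_lift_add[of g "f - f'" f'] by simp

lemma free_lift_single [simp]: "free_lift scale g (Poly_Mapping.single x c) = scale c (g x)"
  by (simp add: free_lift_def)

end


section \<open>Tensor powers\<close>

text \<open>
  For a vector space with scalar multiplication \<open>sc\<close>, the spaces \<open>V \<otimes> V\<close> and \<open>V \<otimes> V \<otimes> V\<close> are
  the quotients of the free vector spaces on pairs and on triples by the subspaces spanned by the
  multilinearity relations. Their elements are cosets, and operations on cosets are defined through
  arbitrarily chosen representatives (as in a \<open>quotient_type\<close>, which is not available here because
  the relations depend on the term \<open>sc\<close>).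
\<close>

definition tens_null :: "('k::field \<Rightarrow> 'v::ab_group_add \<Rightarrow> 'v) \<Rightarrow> ('v \<times> 'v \<Rightarrow>\<^sub>0 'k) set" where
  "tens_null sc = free.span
    ({Poly_Mapping.single (a + a', b) 1 - Poly_Mapping.single (a, b) 1
        - Poly_Mapping.single (a', b) 1 | a a' b. True} \<union>
     {Poly_Mapping.single (a, b + b') 1 - Poly_Mapping.single (a, b) 1
        - Poly_Mapping.single (a, b') 1 | a b b'. True} \<union>
     {Poly_Mapping.single (sc c a, b) 1 - Poly_Mapping.single (a, b) c | c a b. True} \<union>
     {Poly_Mapping.single (a, sc c b) 1 - Poly_Mapping.single (a, b) c | c a b. True})"

definition tens_cls ::
  "('k::field \<Rightarrow> 'v::ab_group_add \<Rightarrow> 'v) \<Rightarrow> ('v \<times> 'v \<Rightarrow>\<^sub>0 'k) \<Rightarrow> ('v \<times> 'v \<Rightarrow>\<^sub>0 'k) set" where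
  "tens_cls sc f = {g. g - f \<in> tens_null sc}"

definition tens_space ::
  "('k::field \<Rightarrow> 'v::ab_group_add \<Rightarrow> 'v) \<Rightarrow> ('v \<times> 'v \<Rightarrow>\<^sub>0 'k) set set" where
  "tens_space sc = {tens_cls sc f | f. True}"

definition tens_rep :: "'x set \<Rightarrow> 'x" where
  "tens_rep X = (SOME f. f \<in> X)"

definition tens_pure ::
  "('k::field \<Rightarrow> 'v::ab_group_add \<Rightarrow> 'v) \<Rightarrow> 'v \<Rightarrow> 'v \<Rightarrow> ('v \<times> 'v \<Rightarrow>\<^sub>0 'k) set" where
  "tens_pure sc a b = tens_cls sc (Poly_Mapping.single (a, b) 1)"

definition tens_add ::
  "('k::field \<Rightarrow> 'v::ab_group_add \<Rightarrow> 'v) \<Rightarrow>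
    ('v \<times> 'v \<Rightarrow>\<^sub>0 'k) set \<Rightarrow> ('v \<times> 'v \<Rightarrow>\<^sub>0 'k) set \<Rightarrow> ('v \<times> 'v \<Rightarrow>\<^sub>0 'k) set" where
  "tens_add sc X Y = tens_cls sc (tens_rep X + tens_rep Y)"

definition tens_scale ::
  "('k::field \<Rightarrow> 'v::ab_group_add \<Rightarrow> 'v) \<Rightarrow>
    'k \<Rightarrow> ('v \<times> 'v \<Rightarrow>\<^sub>0 'k) set \<Rightarrow> ('v \<times> 'v \<Rightarrow>\<^sub>0 'k) set" where
  "tens_scale sc c X = tens_cls sc (free_scale c (tens_rep X))"

text \<open>The product of \<open>A \<otimes> A\<close>, with \<open>(a \<otimes> b) (c \<otimes> d) = a c \<otimes> b d\<close>.\<close>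

definition tens_mult ::
  "('k::field \<Rightarrow> 'a::ring_1 \<Rightarrow> 'a) \<Rightarrow>
    ('a \<times> 'a \<Rightarrow>\<^sub>0 'k) set \<Rightarrow> ('a \<times> 'a \<Rightarrow>\<^sub>0 'k) set \<Rightarrow> ('a \<times> 'a \<Rightarrow>\<^sub>0 'k) set" where
  "tens_mult sc X Y = tens_cls sc
    (free_lift free_scale
      (\<lambda>(a, b). free_lift free_scale
        (\<lambda>(c, d). Poly_Mapping.single (a * c, b * d) 1) (tens_rep Y)) (tens_rep X))"

text \<open>The linear map \<open>V \<otimes> V \<rightarrow> V\<close> induced by a bilinear map \<open>\<beta>\<close>.\<close>

definition tens_lift ::
  "('k::field \<Rightarrow> 'v::ab_group_add \<Rightarrow> 'v) \<Rightarrow> ('v \<Rightarrow> 'v \<Rightarrow> 'v) \<Rightarrow> ('v \<times> 'v \<Rightarrow>\<^sub>0 'k) set \<Rightarrow> 'v" where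
  "tens_lift sc \<beta> X = free_lift sc (\<lambda>(a, b). \<beta> a b) (tens_rep X)"

text \<open>
  The subspace of \<open>V \<otimes> V\<close> spanned by all \<open>a \<otimes> b\<close> with \<open>(a, b) \<in> P\<close>. For \<open>P = U \<times> W\<close> it is
  \<open>U \<otimes> W\<close>, and for \<open>P = (\<Union>i. U i \<times> W i)\<close> it is the sum of the \<open>U i \<otimes> W i\<close>.
\<close>

definition tens_span ::
  "('k::field \<Rightarrow> 'v::ab_group_add \<Rightarrow> 'v) \<Rightarrow> ('v \<times> 'v) set \<Rightarrow> ('v \<times> 'v \<Rightarrow>\<^sub>0 'k) set set" where
  "tens_span sc P = tens_cls sc ` free.span {Poly_Mapping.single (a, b) 1 | a b. (a, b) \<in> P}"

definition tens3_null :: "('k::field \<Rightarrow> 'v::ab_group_add \<Rightarrow> 'v) \<Rightarrow> ('v \<times> 'v \<times> 'v \<Rightarrow>\<^sub>0 'k) set" where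
  "tens3_null sc = free.span
    ({Poly_Mapping.single (a + a', b, c) 1 - Poly_Mapping.single (a, b, c) 1
        - Poly_Mapping.single (a', b, c) 1 | a a' b c. True} \<union>
     {Poly_Mapping.single (a, b + b', c) 1 - Poly_Mapping.single (a, b, c) 1
        - Poly_Mapping.single (a, b', c) 1 | a b b' c. True} \<union>
     {Poly_Mapping.single (a, b, c + c') 1 - Poly_Mapping.single (a, b, c) 1
        - Poly_Mapping.single (a, b, c') 1 | a b c c'. True} \<union>
     {Poly_Mapping.single (sc t a, b, c) 1 - Poly_Mapping.single (a, b, c) t | t a b c. True} \<union>
     {Poly_Mapping.single (a, sc t b, c) 1 - Poly_Mapping.single (a, b, c) t | t a b c. True} \<union>
     {Poly_Mapping.single (a, b, sc t c) 1 - Poly_Mapping.single (a, b, c) t | t a b c. True})"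

definition tens3_cls ::
  "('k::field \<Rightarrow> 'v::ab_group_add \<Rightarrow> 'v) \<Rightarrow>
    ('v \<times> 'v \<times> 'v \<Rightarrow>\<^sub>0 'k) \<Rightarrow> ('v \<times> 'v \<times> 'v \<Rightarrow>\<^sub>0 'k) set" where
  "tens3_cls sc f = {g. g - f \<in> tens3_null sc}"

text \<open>The maps \<open>D \<otimes> id\<close> and \<open>id \<otimes> D\<close> from \<open>V \<otimes> V\<close> to \<open>V \<otimes> V \<otimes> V\<close>, for \<open>D : V \<rightarrow> V \<otimes> V\<close>.\<close>

definition tens_map_left ::
  "('k::field \<Rightarrow> 'v::ab_group_add \<Rightarrow> 'v) \<Rightarrow> ('v \<Rightarrow> ('v \<times> 'v \<Rightarrow>\<^sub>0 'k) set) \<Rightarrow>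
    ('v \<times> 'v \<Rightarrow>\<^sub>0 'k) set \<Rightarrow> ('v \<times> 'v \<times> 'v \<Rightarrow>\<^sub>0 'k) set" where
  "tens_map_left sc D X = tens3_cls sc
    (free_lift free_scale
      (\<lambda>(a, b). free_lift free_scale
        (\<lambda>(c, d). Poly_Mapping.single (c, d, b) 1) (tens_rep (D a))) (tens_rep X))"

definition tens_map_right ::
  "('k::field \<Rightarrow> 'v::ab_group_add \<Rightarrow> 'v) \<Rightarrow> ('v \<Rightarrow> ('v \<times> 'v \<Rightarrow>\<^sub>0 'k) set) \<Rightarrow>
    ('v \<times> 'v \<Rightarrow>\<^sub>0 'k) set \<Rightarrow> ('v \<times> 'v \<times> 'v \<Rightarrow>\<^sub>0 'k) set" where
  "tens_map_right sc D X = tens3_cls sc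
    (free_lift free_scale
      (\<lambda>(a, b). free_lift free_scale
        (\<lambda>(c, d). Poly_Mapping.single (a, c, d) 1) (tens_rep (D b))) (tens_rep X))"

text \<open>Independence of the representatives, and the universal property of \<^const>\<open>tens_lift\<close>.\<close>

lemma tens_cls_eq_iff: "tens_cls sc f = tens_cls sc g \<longleftrightarrow> f - g \<in> tens_null sc"
proof
  assume "tens_cls sc f = tens_cls sc g"
  moreover have "f \<in> tens_cls sc f" by (simp add: tens_cls_def tens_null_def free.span_zero)
  ultimately show "f - g \<in> tens_null sc" by (simp add: tens_cls_def)
next
  assume *: "f - g \<in> tens_null sc"
  have "h - f \<in> tens_null sc \<longleftrightarrow> h - g \<in> tens_null sc" for h
  proof
    assume "h - f \<in> tens_null sc"
    then show "h - g \<in> tens_null sc"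
      using free.span_add[OF _ *[unfolded tens_null_def], of "h - f"] by (simp add: tens_null_def)
  next
    assume "h - g \<in> tens_null sc"
    then show "h - f \<in> tens_null sc"
      using free.span_diff[OF _ *[unfolded tens_null_def], of "h - g"] by (simp add: tens_null_def)
  qed
  then show "tens_cls sc f = tens_cls sc g" by (auto simp: tens_cls_def)
qed

lemma tens_rep_cls: "tens_rep (tens_cls sc f) - f \<in> tens_null sc"
proof -
  have "f \<in> tens_cls sc f" by (simp add: tens_cls_def tens_null_def free.span_zero)
  then have "tens_rep (tens_cls sc f) \<in> tens_cls sc f" unfolding tens_rep_def by (rule someI)
  then show ?thesis by (simp add: tens_cls_def)
qed

lemma tens_cls_rep: "X \<in> tens_space sc \<Longrightarrow> tens_cls sc (tens_rep X) = X"
  unfolding tens_space_def using tens_cls_eq_iff tens_rep_cls by blast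

lemma tens_add_cls: "tens_add sc (tens_cls sc f) (tens_cls sc g) = tens_cls sc (f + g)"
proof -
  have "(tens_rep (tens_cls sc f) - f) + (tens_rep (tens_cls sc g) - g) \<in> tens_null sc"
    using tens_rep_cls[of sc f] tens_rep_cls[of sc g] by (simp add: tens_null_def free.span_add)
  then show ?thesis by (simp add: tens_add_def tens_cls_eq_iff algebra_simps)
qed

lemma tens_scale_cls: "tens_scale sc c (tens_cls sc f) = tens_cls sc (free_scale c f)"
proof -
  have "free_scale c (tens_rep (tens_cls sc f) - f) \<in> tens_null sc"
    using tens_rep_cls[of sc f] by (simp add: tens_null_def free.span_scale)
  then show ?thesis by (simp add: tens_scale_def tens_cls_eq_iff free.scale_right_diff_distrib)
qed

lemma (in vector_space) free_lift_tens_null: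
  assumes W: "subspace W" and f: "f \<in> tens_null sc"
    and "\<And>a a' b. g (a + a', b) - g (a, b) - g (a', b) \<in> W"
    and "\<And>a b b'. g (a, b + b') - g (a, b) - g (a, b') \<in> W"
    and "\<And>c a b. g (sc c a, b) - scale c (g (a, b)) \<in> W"
    and "\<And>c a b. g (a, sc c b) - scale c (g (a, b)) \<in> W"
  shows "free_lift scale g f \<in> W"
  using f unfolding tens_null_def
proof (induction rule: free.span_induct)
  case base
  have "free_lift scale g 0 = 0" by (simp add: free_lift_def)
  then show ?case
    using W unfolding free.subspace_def
    by (auto simp: free_lift_add free_lift_scale subspace_add subspace_scale subspace_0)
next
  case (step x)
  then show ?case using assms(3-6) by (auto simp: free_lift_diff)
qed

lemma (in vector_space) tens_lift_cls:
  assumes "\<And>a a' b. \<beta> (a + a') b = \<beta> a b + \<beta> a' b"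
    and "\<And>a b b'. \<beta> a (b + b') = \<beta> a b + \<beta> a b'"
    and "\<And>c a b. \<beta> (scale c a) b = scale c (\<beta> a b)"
    and "\<And>c a b. \<beta> a (scale c b) = scale c (\<beta> a b)"
  shows "tens_lift scale \<beta> (tens_cls scale f) = free_lift scale (\<lambda>(a, b). \<beta> a b) f"
proof -
  have "free_lift scale (\<lambda>(a, b). \<beta> a b) (tens_rep (tens_cls scale f) - f) \<in> {0}"
    by (rule free_lift_tens_null[OF _ tens_rep_cls]) (simp_all add: assms)
  then show ?thesis by (simp add: tens_lift_def free_lift_diff)
qed


section \<open>Algebras, Gelfand-Kirillov dimension and Ore extensions\<close>

locale k_algebra = vector_space scale
  for scale :: "'k::field \<Rightarrow> 'a::ring_1 \<Rightarrow> 'a" +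
  assumes scale_mult_left: "scale c x * y = scale c (x * y)"
    and scale_mult_right: "x * scale c y = scale c (x * y)"

definition subalgebra :: "('k::field \<Rightarrow> 'a::ring_1 \<Rightarrow> 'a) \<Rightarrow> 'a set \<Rightarrow> bool" where
  "subalgebra sc B \<longleftrightarrow> module.subspace sc B \<and> 1 \<in> B \<and> (\<forall>x\<in>B. \<forall>y\<in>B. x * y \<in> B)"

definition scalars :: "('k::field \<Rightarrow> 'a::ring_1 \<Rightarrow> 'a) \<Rightarrow> 'a set" where
  "scalars sc = {sc c 1 | c. True}"

definition generated_subalgebra :: "('k::field \<Rightarrow> 'a::ring_1 \<Rightarrow> 'a) \<Rightarrow> 'a set \<Rightarrow> 'a set" where
  "generated_subalgebra sc X = subalgebra sc hull X"

lemma (in k_algebra) generated_subalgebra_empty: "generated_subalgebra scale {} = scalars scale"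
  unfolding generated_subalgebra_def
proof (rule hull_unique)
  have "\<exists>c. scale a 1 * scale b 1 = scale c 1" for a b
    by (auto simp: scale_mult_left)
  moreover have "\<exists>c. scale a 1 + scale b 1 = scale c 1" for a b
    by (metis scale_left_distrib)
  moreover have "\<exists>c. 0 = scale c 1" "\<exists>c. 1 = scale c 1"
    by (metis scale_zero_left, metis scale_one)
  ultimately show "subalgebra scale (scalars scale)"
    by (auto simp: subalgebra_def subspace_def scalars_def)
next
  fix B assume "subalgebra scale B"
  then show "scalars scale \<subseteq> B"
    by (auto simp: subalgebra_def scalars_def subspace_scale)
qed simp

text \<open>
  The supremum over all finite-dimensional subspaces \<open>V\<close> of the upper limit of
  \<open>log\<^sub>n dim (V\<^sup>0 + V\<^sup>1 + \<dots> + V\<^sup>n)\<close>; the sum of powers is the span of the products of at most \<open>n\<close>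
  elements of \<open>V\<close>, and the dimension of a set is that of its span.
\<close>

definition gk_dim :: "('k::field \<Rightarrow> 'a::ring_1 \<Rightarrow> 'a) \<Rightarrow> ereal" where
  "gk_dim sc = (SUP V\<in>{module.span sc F | F. finite F}.
     limsup (\<lambda>n. ereal (log (real n) (real (vector_space.dim sc
       (module.span sc {prod_list xs | xs. length xs \<le> n \<and> set xs \<subseteq> V}))))))"

definition algebra_automorphism ::
  "('k::field \<Rightarrow> 'a::ring_1 \<Rightarrow> 'a) \<Rightarrow> 'a set \<Rightarrow> ('a \<Rightarrow> 'a) \<Rightarrow> bool" where
  "algebra_automorphism sc A \<sigma> \<longleftrightarrow> bij_betw \<sigma> A A \<and> \<sigma> 1 = 1 \<and>
     (\<forall>a\<in>A. \<forall>b\<in>A. \<sigma> (a + b) = \<sigma> a + \<sigma> b \<and> \<sigma> (a * b) = \<sigma> a * \<sigma> b) \<and>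
     (\<forall>c. \<forall>a\<in>A. \<sigma> (sc c a) = sc c (\<sigma> a))"

definition skew_derivation ::
  "('k::field \<Rightarrow> 'a::ring_1 \<Rightarrow> 'a) \<Rightarrow> 'a set \<Rightarrow> ('a \<Rightarrow> 'a) \<Rightarrow> ('a \<Rightarrow> 'a) \<Rightarrow> bool" where
  "skew_derivation sc A \<sigma> \<delta> \<longleftrightarrow> (\<forall>a\<in>A. \<delta> a \<in> A) \<and>
     (\<forall>a\<in>A. \<forall>b\<in>A. \<delta> (a + b) = \<delta> a + \<delta> b \<and> \<delta> (a * b) = \<sigma> a * \<delta> b + \<delta> a * b) \<and>
     (\<forall>c. \<forall>a\<in>A. \<delta> (sc c a) = sc c (\<delta> a))"

abbreviation derivation ::
  "('k::field \<Rightarrow> 'a::ring_1 \<Rightarrow> 'a) \<Rightarrow> 'a set \<Rightarrow> ('a \<Rightarrow> 'a) \<Rightarrow> bool" where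
  "derivation sc A \<delta> \<equiv> skew_derivation sc A (\<lambda>a. a) \<delta>"

text \<open>\<open>B = A[z; \<sigma>, \<delta>]\<close>, for subalgebras \<open>A\<close> and \<open>B\<close> of an ambient algebra.\<close>

definition ore_extension ::
  "('k::field \<Rightarrow> 'a::ring_1 \<Rightarrow> 'a) \<Rightarrow> 'a set \<Rightarrow> 'a \<Rightarrow> ('a \<Rightarrow> 'a) \<Rightarrow> ('a \<Rightarrow> 'a) \<Rightarrow> 'a set \<Rightarrow> bool" where
  "ore_extension sc A z \<sigma> \<delta> B \<longleftrightarrow>
     subalgebra sc A \<and> subalgebra sc B \<and> A \<subseteq> B \<and> z \<in> B \<and>
     algebra_automorphism sc A \<sigma> \<and> skew_derivation sc A \<sigma> \<delta> \<and>
     (\<forall>a\<in>A. z * a = \<sigma> a * z + \<delta> a) \<and>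
     (\<forall>b\<in>B. \<exists>!c :: nat \<Rightarrow> 'a. (\<forall>i. c i \<in> A) \<and> finite {i. c i \<noteq> 0} \<and>
        b = (\<Sum>i | c i \<noteq> 0. c i * z ^ i))"

text \<open>\<open>B = A[z; \<delta>]\<close>\<close>

abbreviation differential_ore_extension ::
  "('k::field \<Rightarrow> 'a::ring_1 \<Rightarrow> 'a) \<Rightarrow> 'a set \<Rightarrow> 'a \<Rightarrow> ('a \<Rightarrow> 'a) \<Rightarrow> 'a set \<Rightarrow> bool" where
  "differential_ore_extension sc A z \<delta> B \<equiv> ore_extension sc A z (\<lambda>a. a) \<delta> B"

text \<open>\<open>B = k[z]\<close>: evaluation at \<open>z\<close> is a bijection from the polynomial ring onto \<open>B\<close>.\<close>

definition polynomial_algebra ::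
  "('k::field \<Rightarrow> 'a::ring_1 \<Rightarrow> 'a) \<Rightarrow> 'a \<Rightarrow> 'a set \<Rightarrow> bool" where
  "polynomial_algebra sc z B \<longleftrightarrow>
     bij_betw (\<lambda>p :: 'k poly. \<Sum>i\<le>degree p. sc (coeff p i) (z ^ i)) UNIV B"


section \<open>Hopf algebras\<close>

locale hopf_algebra = k_algebra scale
  for scale :: "'k::field \<Rightarrow> 'h::ring_1 \<Rightarrow> 'h" +
  fixes \<Delta> :: "'h \<Rightarrow> ('h \<times> 'h \<Rightarrow>\<^sub>0 'k) set"
    and \<epsilon> :: "'h \<Rightarrow> 'k"
    and S :: "'h \<Rightarrow> 'h"
  assumes comult_space: "\<Delta> x \<in> tens_space scale"
    and comult_add: "\<Delta> (x + y) = tens_add scale (\<Delta> x) (\<Delta> y)"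
    and comult_scale: "\<Delta> (scale c x) = tens_scale scale c (\<Delta> x)"
    and counit_add: "\<epsilon> (x + y) = \<epsilon> x + \<epsilon> y"
    and counit_scale: "\<epsilon> (scale c x) = c * \<epsilon> x"
    and coassoc: "tens_map_left scale \<Delta> (\<Delta> x) = tens_map_right scale \<Delta> (\<Delta> x)"
    and counit_left: "tens_lift scale (\<lambda>a b. scale (\<epsilon> a) b) (\<Delta> x) = x"
    and counit_right: "tens_lift scale (\<lambda>a b. scale (\<epsilon> b) a) (\<Delta> x) = x"
    and comult_one: "\<Delta> 1 = tens_pure scale 1 1"
    and comult_mult: "\<Delta> (x * y) = tens_mult scale (\<Delta> x) (\<Delta> y)"
    and counit_one: "\<epsilon> 1 = 1"
    and counit_mult: "\<epsilon> (x * y) = \<epsilon> x * \<epsilon> y"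
    and antipode_add: "S (x + y) = S x + S y"
    and antipode_scale: "S (scale c x) = scale c (S x)"
    and antipode_left: "tens_lift scale (\<lambda>a b. S a * b) (\<Delta> x) = scale (\<epsilon> x) 1"
    and antipode_right: "tens_lift scale (\<lambda>a b. a * S b) (\<Delta> x) = scale (\<epsilon> x) 1"

locale graded_hopf_algebra = hopf_algebra scale \<Delta> \<epsilon> S
  for scale :: "'k::field \<Rightarrow> 'h::ring_1 \<Rightarrow> 'h"
    and \<Delta> :: "'h \<Rightarrow> ('h \<times> 'h \<Rightarrow>\<^sub>0 'k) set"
    and \<epsilon> :: "'h \<Rightarrow> 'k"
    and S :: "'h \<Rightarrow> 'h" +
  fixes H :: "nat \<Rightarrow> 'h set"
  assumes grade_subspace: "subspace (H n)"
    and grade_direct_sum: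
      "\<exists>!f :: nat \<Rightarrow> 'h. (\<forall>n. f n \<in> H n) \<and> finite {n. f n \<noteq> 0} \<and> x = (\<Sum>n | f n \<noteq> 0. f n)"
    and grade_one: "1 \<in> H 0"
    and grade_mult: "x \<in> H m \<Longrightarrow> y \<in> H n \<Longrightarrow> x * y \<in> H (m + n)"
    and grade_comult: "x \<in> H n \<Longrightarrow> \<Delta> x \<in> tens_span scale (\<Union>(i, j)\<in>{(i, j). i + j = n}. H i \<times> H j)"
    and grade_counit: "x \<in> H n \<Longrightarrow> n > 0 \<Longrightarrow> \<epsilon> x = 0"
    and grade_antipode: "x \<in> H n \<Longrightarrow> S x \<in> H n"

locale connected_graded_hopf_algebra = graded_hopf_algebra scale \<Delta> \<epsilon> S H
  for scale :: "'k::field \<Rightarrow> 'h::ring_1 \<Rightarrow> 'h"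
    and \<Delta> :: "'h \<Rightarrow> ('h \<times> 'h \<Rightarrow>\<^sub>0 'k) set"
    and \<epsilon> :: "'h \<Rightarrow> 'k"
    and S :: "'h \<Rightarrow> 'h"
    and H :: "nat \<Rightarrow> 'h set" +
  assumes connected: "dim (H 0) = 1"

definition hopf_subalgebra ::
  "('k::field \<Rightarrow> 'h::ring_1 \<Rightarrow> 'h) \<Rightarrow> ('h \<Rightarrow> ('h \<times> 'h \<Rightarrow>\<^sub>0 'k) set) \<Rightarrow> ('h \<Rightarrow> 'h) \<Rightarrow>
    'h set \<Rightarrow> bool" where
  "hopf_subalgebra sc \<Delta> S B \<longleftrightarrow>
     subalgebra sc B \<and> (\<forall>x\<in>B. \<Delta> x \<in> tens_span sc (B \<times> B)) \<and> (\<forall>x\<in>B. S x \<in> B)"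

text \<open>
  A Hopf subalgebra that is the sum of its homogeneous parts \<open>B \<inter> H n\<close> (directness of the sum is
  inherited from the ambient grading).
\<close>

definition graded_hopf_subalgebra ::
  "('k::field \<Rightarrow> 'h::ring_1 \<Rightarrow> 'h) \<Rightarrow> ('h \<Rightarrow> ('h \<times> 'h \<Rightarrow>\<^sub>0 'k) set) \<Rightarrow> ('h \<Rightarrow> 'h) \<Rightarrow>
    (nat \<Rightarrow> 'h set) \<Rightarrow> 'h set \<Rightarrow> bool" where
  "graded_hopf_subalgebra sc \<Delta> S H B \<longleftrightarrow>
     hopf_subalgebra sc \<Delta> S B \<and> B = module.span sc (\<Union>n. B \<inter> H n) \<and>
     (\<forall>n. \<forall>x\<in>B \<inter> H n.
        \<Delta> x \<in> tens_span sc (\<Union>(i, j)\<in>{(i, j). i + j = n}. (B \<inter> H i) \<times> (B \<inter> H j)))"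

definition iterated_hopf_ore_extension ::
  "('k::field \<Rightarrow> 'h::ring_1 \<Rightarrow> 'h) \<Rightarrow> ('h \<Rightarrow> ('h \<times> 'h \<Rightarrow>\<^sub>0 'k) set) \<Rightarrow> ('h \<Rightarrow> 'h) \<Rightarrow> bool" where
  "iterated_hopf_ore_extension sc \<Delta> S \<longleftrightarrow>
     (\<exists>n (C :: nat \<Rightarrow> 'h set). C 0 = scalars sc \<and> C n = UNIV \<and>
        (\<forall>i\<le>n. hopf_subalgebra sc \<Delta> S (C i)) \<and>
        (\<forall>i<n. \<exists>x \<sigma> \<delta>. ore_extension sc (C i) x \<sigma> \<delta> (C (Suc i))))"

end

theory Submission
  imports Defs
begin

text \<open>
  The generators are split off one at a time, starting from the top degree.

  Let \<open>B\<close> be a graded Hopf subalgebra that is generated in bounded degree, and let \<open>n\<close> be the highest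
  degree in which \<open>B\<close> contains an element \<open>z\<close> that is not a sum of products of elements of positive
  degree. Choose a functional \<open>\<xi>\<close>, concentrated in degree \<open>n\<close>, that vanishes on all such products and
  has \<open>\<xi> z = 1\<close>. Then \<open>D = (id \<otimes> \<xi>) \<Delta>\<close> is a derivation of \<open>B\<close> that lowers degrees by \<open>n\<close>, and
  \<open>D z = 1\<close>. In characteristic \<open>0\<close> a locally nilpotent derivation with such a slice \<open>z\<close> makes \<open>B\<close> an Ore
  extension \<open>A[z; \<delta>]\<close> of its ring of constants \<open>A\<close>, with \<open>\<delta> a = z a - a z\<close>: powers
  of \<open>D\<close> read off the coefficients of a polynomial in \<open>z\<close>, and \<open>D\<close> kills \<open>z a - a z\<close> because \<open>D z = 1\<close> is
  central (\<open>derivation_with_slice.ore_extension_constants\<close>).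

  The subalgebra \<open>A\<close> is again a graded Hopf subalgebra. By coassociativity the kernel of \<open>D\<close> is a left
  coideal, and the kernel of \<open>(\<xi> \<otimes> id) \<Delta>\<close> is a right coideal. Since \<open>n\<close> is the top degree, these two
  derivations agree on generators, hence on \<open>B\<close> (\<open>contract_left_eq_right\<close>); in terms of the graded dual,
  a primitive element of top degree is central. So \<open>\<Delta> A\<close> lies in \<open>A \<otimes> A\<close>. Moreover \<open>D\<close> kills every
  element of degree less than \<open>n\<close>, so for \<open>z\<close> in degree \<open>n\<close> the middle terms of \<open>\<Delta> z\<close> lie in \<open>A \<otimes> A\<close>
  (\<open>ore_step_exists\<close>).

  The Gelfand-Kirillov dimension enters through the length of towers in which every new element is
  free over a subalgebra containing the earlier ones: a tower of length \<open>p\<close> yields linearly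
  independent ordered monomials in \<open>p\<close> variables, so \<open>p\<close> is at most the dimension
  (\<open>free_tower_le_gk_dim\<close>). First, this bounds the degrees of generators. If generators \<open>z\<^sub>1, \<dots>, z\<^sub>p\<close> sit in
  degrees \<open>n\<^sub>1 < \<dots> < n\<^sub>p\<close>, with functionals \<open>\<xi>\<^sub>i\<close> as above, then the \<open>i\<close>-th derivation kills
  \<open>z\<^sub>j\<close> for \<open>j < i\<close> for reasons of degree, and the \<open>z\<^sub>i\<close> form a tower
  (\<open>generator_degrees_free_tower\<close>). Second, it makes the passage from \<open>B\<close> to \<open>A\<close> terminate
  (\<open>ore_chain_exists\<close>). When it stops, the ordered monomials in the \<open>d\<close> generators split off span \<open>H\<close>,
  and counting them by degree bounds the dimension above by \<open>d\<close> (\<open>gk_dim_le\<close>).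
\<close>


section \<open>The tensor square as a space of finitely supported functions\<close>

lemma keys_subset_iff_free_span:
  fixes f :: "'x \<times> 'y \<Rightarrow>\<^sub>0 'k::field"
  shows "Poly_Mapping.keys f \<subseteq> P \<longleftrightarrow>
    f \<in> free.span {Poly_Mapping.single (a, b) 1 | a b. (a, b) \<in> P}"
proof
  assume "Poly_Mapping.keys f \<subseteq> P"
  then have "\<And>p. p \<in> Poly_Mapping.keys f \<Longrightarrow>
      free_scale (Poly_Mapping.lookup f p) (Poly_Mapping.single p 1)
        \<in> free.span {Poly_Mapping.single (a, b) 1 | a b. (a, b) \<in> P}"
    by (intro free.span_scale free.span_base) auto
  moreover have "f = (\<Sum>p\<in>Poly_Mapping.keys f.
      free_scale (Poly_Mapping.lookup f p) (Poly_Mapping.single p 1))"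
  proof (rule poly_mapping_eqI)
    fix q
    show "Poly_Mapping.lookup f q = Poly_Mapping.lookup (\<Sum>p\<in>Poly_Mapping.keys f.
      free_scale (Poly_Mapping.lookup f p) (Poly_Mapping.single p 1)) q"
      by (simp add: lookup_sum lookup_single when_def if_distrib in_keys_iff cong: if_cong)
  qed
  ultimately show "f \<in> free.span {Poly_Mapping.single (a, b) 1 | a b. (a, b) \<in> P}"
    by (metis (no_types, lifting) free.span_sum)
next
  assume "f \<in> free.span {Poly_Mapping.single (a, b) 1 | a b. (a, b) \<in> P}"
  then show "Poly_Mapping.keys f \<subseteq> P"
  proof (induction rule: free.span_induct_alt)
    case (step c x y)
    then obtain a b where x: "x = Poly_Mapping.single (a, b) 1" "(a, b) \<in> P" by blast
    have "Poly_Mapping.keys (free_scale c x) \<subseteq> {(a, b)}"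
      by (auto simp: x in_keys_iff lookup_single when_def split: if_splits)
    then show ?case using step x Poly_Mapping.keys_add[of "free_scale c x" y] by blast
  qed simp
qed

lemma tens_span_iff:
  "X \<in> tens_span sc P \<longleftrightarrow> (\<exists>f. Poly_Mapping.keys f \<subseteq> P \<and> X = tens_cls sc f)"
  by (auto simp: tens_span_def keys_subset_iff_free_span)

context vector_space
begin

lemma free_lift_zero [simp]: "free_lift scale g 0 = 0"
  by (simp add: free_lift_def)

lemma free_lift_sum: "free_lift scale g (\<Sum>i\<in>I. f i) = (\<Sum>i\<in>I. free_lift scale g (f i))"
  by (induction I rule: infinite_finite_induct) (simp_all add: free_lift_add)

lemma free_lift_fun_add:
  "free_lift scale (\<lambda>x. g x + h x) f = free_lift scale g f + free_lift scale h f"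
  by (simp add: free_lift_def scale_right_distrib sum.distrib)

lemma free_lift_fun_scale:
  "free_lift scale (\<lambda>x. scale c (g x)) f = scale c (free_lift scale g f)"
  by (simp add: free_lift_def scale_sum_right mult.commute)

lemma free_lift_cong:
  "(\<And>x. x \<in> Poly_Mapping.keys f \<Longrightarrow> g x = h x) \<Longrightarrow> free_lift scale g f = free_lift scale h f"
  by (simp add: free_lift_def)

lemma free_lift_in_subspace:
  "subspace W \<Longrightarrow> (\<And>x. x \<in> Poly_Mapping.keys f \<Longrightarrow> g x \<in> W) \<Longrightarrow> free_lift scale g f \<in> W"
  by (simp add: free_lift_def subspace_sum subspace_scale)

lemma free_lift_hom:
  assumes "module_hom s scale L" and "vector_space s"
  shows "L (free_lift s g f) = free_lift scale (\<lambda>x. L (g x)) f"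
proof -
  interpret L: module_hom s scale L by fact
  show ?thesis by (simp add: free_lift_def L.sum L.scale)
qed

text \<open>
  Together with \<open>free_lift_hom\<close> this turns the nested linear extensions in the definitions of the
  product on \<open>A \<otimes> A\<close> and of \<open>D \<otimes> id\<close> into iterated sums.
\<close>

lemma free_lift_free_lift:
  "free_lift scale g (free_lift free_scale h f) = free_lift scale (\<lambda>x. free_lift scale g (h x)) f"
proof -
  have "free_lift free_scale h f
      = (\<Sum>x\<in>Poly_Mapping.keys f. free_scale (Poly_Mapping.lookup f x) (h x))"
    by (simp add: free_lift_def)
  then show ?thesis
    by (simp add: free_lift_sum free_lift_scale free_lift_def[of scale _ f])
qed

end

lemma free_lift_self: "free_lift free_scale (\<lambda>x. Poly_Mapping.single x 1) f = f"
proof (rule poly_mapping_eqI)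
  fix q
  show "Poly_Mapping.lookup (free_lift free_scale (\<lambda>x. Poly_Mapping.single x 1) f) q
      = Poly_Mapping.lookup f q"
    by (simp add: free_lift_def lookup_sum lookup_single when_def if_distrib in_keys_iff cong: if_cong)
qed

definition bilinear_map ::
  "('k::field \<Rightarrow> 'v::ab_group_add \<Rightarrow> 'v) \<Rightarrow> ('k \<Rightarrow> 'w::ab_group_add \<Rightarrow> 'w) \<Rightarrow> ('v \<Rightarrow> 'v \<Rightarrow> 'w) \<Rightarrow> bool"
  where "bilinear_map sc s \<beta> \<longleftrightarrow>
    (\<forall>a a' b. \<beta> (a + a') b = \<beta> a b + \<beta> a' b) \<and> (\<forall>a b b'. \<beta> a (b + b') = \<beta> a b + \<beta> a b') \<and>
    (\<forall>c a b. \<beta> (sc c a) b = s c (\<beta> a b)) \<and> (\<forall>c a b. \<beta> a (sc c b) = s c (\<beta> a b))"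

lemma bilinear_mapI:
  assumes "\<And>a a' b. \<beta> (a + a') b = \<beta> a b + \<beta> a' b" "\<And>a b b'. \<beta> a (b + b') = \<beta> a b + \<beta> a b'"
    "\<And>c a b. \<beta> (sc c a) b = s c (\<beta> a b)" "\<And>c a b. \<beta> a (sc c b) = s c (\<beta> a b)"
  shows "bilinear_map sc s \<beta>"
  using assms by (simp add: bilinear_map_def)

lemma bilinear_mapD:
  assumes "bilinear_map sc s \<beta>"
  shows "\<beta> (a + a') b = \<beta> a b + \<beta> a' b" "\<beta> a (b + b') = \<beta> a b + \<beta> a b'"
    "\<beta> (sc c a) b = s c (\<beta> a b)" "\<beta> a (sc c b) = s c (\<beta> a b)"
  using assms by (auto simp: bilinear_map_def)

text \<open>
  The universal property of the tensor square: a bilinear map is well defined on classes.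
\<close>

lemma (in vector_space) free_lift_bilinear_cong:
  assumes "bilinear_map sc scale \<beta>" "tens_cls sc f = tens_cls sc g"
  shows "free_lift scale (\<lambda>(a, b). \<beta> a b) f = free_lift scale (\<lambda>(a, b). \<beta> a b) g"
proof -
  have "free_lift scale (\<lambda>(a, b). \<beta> a b) (f - g) \<in> {0}"
    using assms(2) unfolding tens_cls_eq_iff
    by (rule free_lift_tens_null[rotated]) (use assms(1) in \<open>simp_all add: bilinear_map_def\<close>)
  then show ?thesis by (simp add: free_lift_diff)
qed

context k_algebra
begin

text \<open>
  Equality of classes is awkward to calculate with. Fixing a basis of the algebra replaces the
  tensor square by the space of finitely supported functions on pairs of basis vectors, and classes
  by honest values.
\<close>

definition coords :: "'a \<Rightarrow> ('a \<Rightarrow>\<^sub>0 'k)" where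
  "coords v = Abs_poly_mapping (representation (extend_basis {}) v)"

lemma lookup_coords: "Poly_Mapping.lookup (coords v) = representation (extend_basis {}) v"
  using finite_representation by (simp add: coords_def)

lemma coords_add: "coords (v + w) = coords v + coords w"
  by (rule poly_mapping_eqI)
    (simp add: lookup_coords lookup_add representation_add independent_extend_basis independent_empty)

lemma coords_scale: "coords (scale c v) = free_scale c (coords v)"
  by (rule poly_mapping_eqI)
    (simp add: lookup_coords representation_scale independent_extend_basis independent_empty)

lemma free_lift_coords: "free_lift scale (\<lambda>i. i) (coords v) = v"
proof -
  have "Poly_Mapping.keys (coords v) = {i. representation (extend_basis {}) v i \<noteq> 0}"
    by (auto simp: in_keys_iff lookup_coords)
  then show ?thesis
    by (simp add: free_lift_def lookup_coords sum_nonzero_representation_eq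
        independent_extend_basis independent_empty)
qed

definition tprod :: "'a \<Rightarrow> 'a \<Rightarrow> ('a \<times> 'a \<Rightarrow>\<^sub>0 'k)" where
  "tprod a b = free_lift free_scale
     (\<lambda>i. free_lift free_scale (\<lambda>j. Poly_Mapping.single (i, j) 1) (coords b)) (coords a)"

lemma bilinear_tprod: "bilinear_map scale free_scale tprod"
  by (rule bilinear_mapI)
    (simp_all add: tprod_def coords_add coords_scale free.free_lift_add free.free_lift_scale
      free.free_lift_fun_add free.free_lift_fun_scale)

lemmas tprod_simps = bilinear_mapD[OF bilinear_tprod]

lemma subspace_tens_null: "free.subspace (tens_null sc)"
  by (simp add: tens_null_def)

text \<open>
  A map that is linear modulo \<open>W\<close> commutes with finite linear combinations modulo \<open>W\<close>. For
  \<open>W\<close> the space of relations this lets a pair be expanded in the basis, one entry at a time.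
\<close>

lemma additive_mod_free_lift:
  assumes W: "free.subspace W"
    and add: "\<And>x y. g (x + y) - g x - g y \<in> W"
    and sc: "\<And>c x. g (scale c x) - free_scale c (g x) \<in> W"
  shows "g (free_lift scale h u) - free_lift free_scale (\<lambda>x. g (h x)) u \<in> W"
proof -
  have "g (\<Sum>x\<in>I. scale (c x) (h x)) - (\<Sum>x\<in>I. free_scale (c x) (g (h x))) \<in> W"
    if "finite I" for I c
    using that
  proof (induction I rule: finite_induct)
    case empty
    show ?case using sc[of 0 0] by (simp add: free.scale_zero_left)
  next
    case (insert x I)
    let ?s = "\<Sum>x\<in>I. scale (c x) (h x)" and ?t = "\<Sum>x\<in>I. free_scale (c x) (g (h x))"
    have "(g (scale (c x) (h x) + ?s) - g (scale (c x) (h x)) - g ?s) +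
        ((g (scale (c x) (h x)) - free_scale (c x) (g (h x))) + (g ?s - ?t)) \<in> W"
      using insert by (intro free.subspace_add[OF W] add sc)
    then show ?case using insert by (simp add: algebra_simps)
  qed
  then show ?thesis by (simp add: free_lift_def)
qed

lemma single_minus_tprod: "Poly_Mapping.single (a, b) 1 - tprod a b \<in> tens_null scale"
proof -
  have base: "Poly_Mapping.single (a + a', b) 1 - Poly_Mapping.single (a, b) 1
        - Poly_Mapping.single (a', b) 1 \<in> tens_null scale"
     "Poly_Mapping.single (a, b + b') 1 - Poly_Mapping.single (a, b) 1
        - Poly_Mapping.single (a, b') 1 \<in> tens_null scale"
     "Poly_Mapping.single (scale c a, b) 1 - free_scale c (Poly_Mapping.single (a, b) 1) \<in> tens_null scale"
     "Poly_Mapping.single (a, scale c b) 1 - free_scale c (Poly_Mapping.single (a, b) 1) \<in> tens_null scale"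
    for a a' b b' c
  proof -
    have *: "free_scale c (Poly_Mapping.single (a, b) 1) = Poly_Mapping.single (a, b) c"
      by (rule poly_mapping_eqI) (simp add: lookup_single when_def)
    show "Poly_Mapping.single (a + a', b) 1 - Poly_Mapping.single (a, b) 1
        - Poly_Mapping.single (a', b) 1 \<in> tens_null scale"
     "Poly_Mapping.single (a, b + b') 1 - Poly_Mapping.single (a, b) 1
        - Poly_Mapping.single (a, b') 1 \<in> tens_null scale"
      "Poly_Mapping.single (scale c a, b) 1 - free_scale c (Poly_Mapping.single (a, b) 1) \<in> tens_null scale"
     "Poly_Mapping.single (a, scale c b) 1 - free_scale c (Poly_Mapping.single (a, b) 1) \<in> tens_null scale"
      unfolding * tens_null_def by (rule free.span_base, blast)+
  qed
  have "Poly_Mapping.single (free_lift scale (\<lambda>i. i) (coords a), b) 1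
      - free_lift free_scale (\<lambda>i. Poly_Mapping.single (i, b) 1) (coords a) \<in> tens_null scale"
    by (rule additive_mod_free_lift[OF subspace_tens_null]) (rule base)+
  moreover have "free_lift free_scale (\<lambda>i. Poly_Mapping.single (i, b) 1) (coords a) - tprod a b
      \<in> tens_null scale"
  proof -
    have "Poly_Mapping.single (i, free_lift scale (\<lambda>i. i) (coords b)) 1
      - free_lift free_scale (\<lambda>j. Poly_Mapping.single (i, j) 1) (coords b) \<in> tens_null scale" for i
      by (rule additive_mod_free_lift[OF subspace_tens_null]) (rule base)+
    then have "free_lift free_scale (\<lambda>i. Poly_Mapping.single (i, b) 1 +
         free_scale (-1) (free_lift free_scale (\<lambda>j. Poly_Mapping.single (i, j) 1) (coords b))) (coords a)
       \<in> tens_null scale"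
      by (intro free.free_lift_in_subspace subspace_tens_null)
        (simp add: free_lift_coords)
    then show ?thesis
      by (simp only: free.free_lift_fun_add free.free_lift_fun_scale tprod_def) simp
  qed
  ultimately show ?thesis
    using free.subspace_add[OF subspace_tens_null] by (fastforce simp: free_lift_coords)
qed

abbreviation tval :: "('a \<times> 'a \<Rightarrow>\<^sub>0 'k) \<Rightarrow> ('a \<times> 'a \<Rightarrow>\<^sub>0 'k)" where
  "tval f \<equiv> free_lift free_scale (\<lambda>(a, b). tprod a b) f"

lemma tval_minus: "f - tval f \<in> tens_null scale"
proof -
  have "free_lift free_scale (\<lambda>p. Poly_Mapping.single p 1 + free_scale (-1) (case p of (a, b) \<Rightarrow> tprod a b)) f
      \<in> tens_null scale"
    using single_minus_tprod by (intro free.free_lift_in_subspace subspace_tens_null) auto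
  then show ?thesis
    by (simp only: free.free_lift_fun_add free.free_lift_fun_scale free_lift_self) simp
qed

text \<open>
  The value of a class in the basis model determines the class, since every representative
  differs from its value by relations only.
\<close>

lemma tens_cls_eq_iff_tval: "tens_cls scale f = tens_cls scale g \<longleftrightarrow> tval f = tval g"
proof
  assume "tens_cls scale f = tens_cls scale g"
  then show "tval f = tval g" by (rule free.free_lift_bilinear_cong[OF bilinear_tprod])
next
  assume *: "tval f = tval g"
  have "(f - tval f) - (g - tval g) \<in> tens_null scale"
    by (intro free.subspace_diff[OF subspace_tens_null] tval_minus)
  then show "tens_cls scale f = tens_cls scale g" by (simp add: * tens_cls_eq_iff)
qed

end


section \<open>Sums over the comultiplication\<close>

context k_algebra
begin

lemma free_lift_mult_left: "free_lift scale (\<lambda>x. u * g x) f = u * free_lift scale g f"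
  by (simp add: free_lift_def sum_distrib_left scale_mult_right)

lemma free_lift_mult_right: "free_lift scale (\<lambda>x. g x * u) f = free_lift scale g f * u"
  by (simp add: free_lift_def sum_distrib_right scale_mult_left)

end

definition trilinear_map ::
  "('k::field \<Rightarrow> 'v::ab_group_add \<Rightarrow> 'v) \<Rightarrow> ('k \<Rightarrow> 'w::ab_group_add \<Rightarrow> 'w) \<Rightarrow> ('v \<Rightarrow> 'v \<Rightarrow> 'v \<Rightarrow> 'w) \<Rightarrow> bool"
  where "trilinear_map sc s \<tau> \<longleftrightarrow>
    (\<forall>c. bilinear_map sc s (\<lambda>a b. \<tau> a b c)) \<and> (\<forall>a. bilinear_map sc s (\<tau> a))"

lemma (in vector_space) free_lift_tens3_null:
  assumes \<tau>: "trilinear_map sc scale \<tau>" and f: "f \<in> tens3_null sc"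
  shows "free_lift scale (\<lambda>(a, b, c). \<tau> a b c) f = 0"
  using f unfolding tens3_null_def
proof (induction rule: free.span_induct)
  case base
  have "free_lift scale g 0 = 0" for g :: "'c \<times> 'c \<times> 'c \<Rightarrow> 'b" by (simp add: free_lift_def)
  then show ?case
    unfolding free.subspace_def by (auto simp: free_lift_add free_lift_scale)
next
  case (step x)
  have l: "\<tau> (a + a') b c = \<tau> a b c + \<tau> a' b c" "\<tau> (sc t a) b c = scale t (\<tau> a b c)"
    "\<tau> a (b + b') c = \<tau> a b c + \<tau> a b' c" "\<tau> a (sc t b) c = scale t (\<tau> a b c)"
    "\<tau> a b (c + c') = \<tau> a b c + \<tau> a b c'" "\<tau> a b (sc t c) = scale t (\<tau> a b c)" for a a' b b' c c' t
    using \<tau> by (simp_all add: trilinear_map_def bilinear_map_def)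
  show ?case using step by (auto simp: free_lift_diff l)
qed

context hopf_algebra
begin

text \<open>
  The sum written \<open>\<Sum> \<beta>(x\<^sub>1, x\<^sub>2)\<close> in Sweedler's notation. The scalar multiplication \<open>s\<close> of the target is
  a parameter because both the algebra itself and the model of its tensor square occur as targets.
\<close>

definition sweedler :: "('k \<Rightarrow> 'v::ab_group_add \<Rightarrow> 'v) \<Rightarrow> ('h \<Rightarrow> 'h \<Rightarrow> 'v) \<Rightarrow> 'h \<Rightarrow> 'v" where
  "sweedler s \<beta> x = free_lift s (\<lambda>(a, b). \<beta> a b) (tens_rep (\<Delta> x))"

lemma comult_rep: "tens_cls scale (tens_rep (\<Delta> x)) = \<Delta> x"
  by (rule tens_cls_rep[OF comult_space])

lemma sweedler_eq:
  assumes "vector_space s" "bilinear_map scale s \<beta>" "\<Delta> x = tens_cls scale f"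
  shows "sweedler s \<beta> x = free_lift s (\<lambda>(a, b). \<beta> a b) f"
  unfolding sweedler_def
  by (rule vector_space.free_lift_bilinear_cong[OF assms(1,2)]) (metis comult_rep assms(3))

lemma sweedler_hom:
  assumes "vector_space s" "bilinear_map scale s \<beta>"
  shows "module_hom scale s (sweedler s \<beta>)"
proof -
  interpret s: vector_space s by fact
  have "sweedler s \<beta> (x + y) = sweedler s \<beta> x + sweedler s \<beta> y" for x y
  proof -
    have "\<Delta> (x + y) = tens_cls scale (tens_rep (\<Delta> x) + tens_rep (\<Delta> y))"
      by (simp add: comult_add tens_add_def)
    from sweedler_eq[OF assms this] show ?thesis by (simp add: s.free_lift_add sweedler_def)
  qed
  moreover have "sweedler s \<beta> (scale c x) = s c (sweedler s \<beta> x)" for c x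
  proof -
    have "\<Delta> (scale c x) = tens_cls scale (free_scale c (tens_rep (\<Delta> x)))"
      by (simp add: comult_scale tens_scale_def)
    from sweedler_eq[OF assms this] show ?thesis by (simp add: s.free_lift_scale sweedler_def)
  qed
  ultimately show ?thesis
    by (simp add: module_hom_iff module_axioms s.module_axioms)
qed

lemma hom_sweedler:
  assumes "module_hom s s' L" "vector_space s" "vector_space s'"
  shows "L (sweedler s \<beta> x) = sweedler s' (\<lambda>a b. L (\<beta> a b)) x"
  using vector_space.free_lift_hom[OF assms(3,1,2)]
  by (simp add: sweedler_def case_prod_unfold)

lemma sweedler_mult:
  assumes s: "vector_space s" and \<beta>: "bilinear_map scale s \<beta>"
  shows "sweedler s \<beta> (x * y) = sweedler s (\<lambda>a b. sweedler s (\<lambda>c d. \<beta> (a * c) (b * d)) y) x"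
proof -
  interpret s: vector_space s by fact
  show ?thesis
    by (subst sweedler_eq[OF s \<beta> comult_mult[unfolded tens_mult_def]])
      (simp add: s.free_lift_free_lift case_prod_unfold sweedler_def)
qed

text \<open>
  In Sweedler's notation: \<open>\<Sum> \<tau>(x\<^sub>1\<^sub>1, x\<^sub>1\<^sub>2, x\<^sub>2) = \<Sum> \<tau>(x\<^sub>1, x\<^sub>2\<^sub>1, x\<^sub>2\<^sub>2)\<close>. The two nested tensors differ by
  relations of the tensor cube, which trilinear maps kill.
\<close>

lemma sweedler_coassoc:
  assumes s: "vector_space s" and \<tau>: "trilinear_map scale s \<tau>"
  shows "sweedler s (\<lambda>a b. sweedler s (\<lambda>c d. \<tau> c d b) a) x
       = sweedler s (\<lambda>a b. sweedler s (\<lambda>c d. \<tau> a c d) b) x"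
proof -
  interpret s: vector_space s by fact
  let ?L = "free_lift free_scale (\<lambda>(a, b). free_lift free_scale
      (\<lambda>(c, d). Poly_Mapping.single (c, d, b) 1) (tens_rep (\<Delta> a))) (tens_rep (\<Delta> x))"
  let ?R = "free_lift free_scale (\<lambda>(a, b). free_lift free_scale
      (\<lambda>(c, d). Poly_Mapping.single (a, c, d) 1) (tens_rep (\<Delta> b))) (tens_rep (\<Delta> x))"
  have "tens3_cls scale ?L = tens3_cls scale ?R"
    using coassoc[of x] by (simp add: tens_map_left_def tens_map_right_def)
  moreover have "?L \<in> tens3_cls scale ?L" by (simp add: tens3_cls_def tens3_null_def free.span_zero)
  ultimately have "?L - ?R \<in> tens3_null scale" by (simp add: tens3_cls_def)
  from s.free_lift_tens3_null[OF \<tau> this]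
  have "free_lift s (\<lambda>(a, b, c). \<tau> a b c) ?L = free_lift s (\<lambda>(a, b, c). \<tau> a b c) ?R"
    by (simp add: s.free_lift_diff)
  then show ?thesis
    by (simp add: s.free_lift_free_lift case_prod_unfold sweedler_def)
qed

lemma sweedler_counit_left: "sweedler scale (\<lambda>a b. scale (\<epsilon> a) b) x = x"
  using counit_left[of x] by (simp add: sweedler_def tens_lift_def)

lemma sweedler_counit_right: "sweedler scale (\<lambda>a b. scale (\<epsilon> b) a) x = x"
  using counit_right[of x] by (simp add: sweedler_def tens_lift_def)

lemma sweedler_antipode: "sweedler scale (\<lambda>a b. S a * b) x = scale (\<epsilon> x) 1"
  using antipode_left[of x] by (simp add: sweedler_def tens_lift_def)

text \<open>
  The coproduct in the basis model of the tensor square. It takes values in a vector space, so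
  unlike \<open>\<Delta>\<close> it is a linear map in the literal sense.
\<close>

definition cop :: "'h \<Rightarrow> ('h \<times> 'h \<Rightarrow>\<^sub>0 'k)" where
  "cop = sweedler free_scale tprod"

lemma comult_eq_iff: "\<Delta> x = tens_cls scale f \<longleftrightarrow> cop x = tval f"
  unfolding cop_def sweedler_def tens_cls_eq_iff_tval[symmetric] comult_rep ..

lemma cop_hom: "module_hom scale free_scale cop"
  unfolding cop_def by (rule sweedler_hom[OF free.vector_space_axioms bilinear_tprod])

text \<open>
  The two actions of the dual algebra: \<open>(id \<otimes> \<xi>) \<Delta>\<close> and, for the left contraction, \<open>(\<xi> \<otimes> id) \<Delta>\<close>.
\<close>

definition contract_right :: "('h \<Rightarrow> 'k) \<Rightarrow> 'h \<Rightarrow> 'h" where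
  "contract_right \<xi> = sweedler scale (\<lambda>a b. scale (\<xi> b) a)"

definition contract_left :: "('h \<Rightarrow> 'k) \<Rightarrow> 'h \<Rightarrow> 'h" where
  "contract_left \<xi> = sweedler scale (\<lambda>a b. scale (\<xi> a) b)"

context
  fixes \<xi> :: "'h \<Rightarrow> 'k"
  assumes \<xi>: "module_hom scale (*) \<xi>"
begin

lemmas functional_add = module_hom.add[OF \<xi>]
lemmas functional_scale = module_hom.scale[OF \<xi>]

lemma bilinear_contract:
  "bilinear_map scale scale (\<lambda>a b. scale (\<xi> b) a)"
  "bilinear_map scale scale (\<lambda>a b. scale (\<xi> a) b)"
  by (rule bilinear_mapI; simp add: functional_add functional_scale scale_right_distrib
      scale_left_distrib mult.commute)+

lemma contract_right_eq:
  "\<Delta> x = tens_cls scale f \<Longrightarrow> contract_right \<xi> x = free_lift scale (\<lambda>(a, b). scale (\<xi> b) a) f"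
  unfolding contract_right_def by (rule sweedler_eq[OF vector_space_axioms bilinear_contract(1)])

lemma contract_left_eq:
  "\<Delta> x = tens_cls scale f \<Longrightarrow> contract_left \<xi> x = free_lift scale (\<lambda>(a, b). scale (\<xi> a) b) f"
  unfolding contract_left_def by (rule sweedler_eq[OF vector_space_axioms bilinear_contract(2)])

lemma contract_hom:
  "module_hom scale scale (contract_right \<xi>)" "module_hom scale scale (contract_left \<xi>)"
  unfolding contract_right_def contract_left_def
  by (rule sweedler_hom[OF vector_space_axioms], rule bilinear_contract)+

text \<open>
  The map \<open>D = (id \<otimes> \<xi>) \<Delta>\<close> satisfies \<open>\<Delta> D = (id \<otimes> D) \<Delta>\<close>, which is coassociativity with \<open>\<xi>\<close> applied to
  the last factor. Hence the kernel of \<open>D\<close> is a left coideal.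
\<close>

lemma cop_contract_right:
  "cop (contract_right \<xi> x) = sweedler free_scale (\<lambda>a b. tprod a (contract_right \<xi> b)) x"
proof -
  let ?\<tau> = "\<lambda>a b c. free_scale (\<xi> c) (tprod a b)"
  have "cop (contract_right \<xi> x) = sweedler free_scale (\<lambda>a b. free_scale (\<xi> b) (cop a)) x"
    unfolding contract_right_def
    using hom_sweedler[OF cop_hom vector_space_axioms free.vector_space_axioms]
    by (simp add: module_hom.scale[OF cop_hom])
  also have "\<dots> = sweedler free_scale (\<lambda>a b. sweedler free_scale (\<lambda>c d. ?\<tau> c d b) a) x"
    unfolding cop_def sweedler_def
    by (simp add: free.free_lift_fun_scale case_prod_unfold)
  also have "\<dots> = sweedler free_scale (\<lambda>a b. sweedler free_scale (\<lambda>c d. ?\<tau> a c d) b) x"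
    by (rule sweedler_coassoc[OF free.vector_space_axioms])
      (simp add: trilinear_map_def bilinear_map_def tprod_simps functional_add functional_scale
        free.scale_right_distrib free.scale_left_distrib mult.commute mult.left_commute)
  also have "\<dots> = sweedler free_scale (\<lambda>a b. tprod a (contract_right \<xi> b)) x"
  proof -
    have "module_hom scale free_scale (tprod a)" for a
      by (simp add: module_hom_iff module_axioms free.module_axioms tprod_simps)
    from hom_sweedler[OF this vector_space_axioms free.vector_space_axioms]
    show ?thesis by (simp add: contract_right_def tprod_simps)
  qed
  finally show ?thesis .
qed

text \<open>
  The mirror image: here \<open>\<xi>\<close> is applied to the first factor.
\<close>

lemma cop_contract_left:
  "cop (contract_left \<xi> x) = sweedler free_scale (\<lambda>a b. tprod (contract_left \<xi> a) b) x"
proof -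
  let ?\<tau> = "\<lambda>a b c. free_scale (\<xi> a) (tprod b c)"
  have "cop (contract_left \<xi> x) = sweedler free_scale (\<lambda>a b. free_scale (\<xi> a) (cop b)) x"
    unfolding contract_left_def
    using hom_sweedler[OF cop_hom vector_space_axioms free.vector_space_axioms]
    by (simp add: module_hom.scale[OF cop_hom])
  also have "\<dots> = sweedler free_scale (\<lambda>a b. sweedler free_scale (\<lambda>c d. ?\<tau> a c d) b) x"
    unfolding cop_def sweedler_def
    by (simp add: free.free_lift_fun_scale case_prod_unfold)
  also have "\<dots> = sweedler free_scale (\<lambda>a b. sweedler free_scale (\<lambda>c d. ?\<tau> c d b) a) x"
    by (rule sweedler_coassoc[OF free.vector_space_axioms, symmetric])
      (simp add: trilinear_map_def bilinear_map_def tprod_simps functional_add functional_scale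
        free.scale_right_distrib free.scale_left_distrib mult.commute mult.left_commute)
  also have "\<dots> = sweedler free_scale (\<lambda>a b. tprod (contract_left \<xi> a) b) x"
  proof -
    have "module_hom scale free_scale (\<lambda>a. tprod a b)" for b
      by (simp add: module_hom_iff module_axioms free.module_axioms tprod_simps)
    from hom_sweedler[OF this vector_space_axioms free.vector_space_axioms]
    show ?thesis by (simp add: contract_left_def tprod_simps)
  qed
  finally show ?thesis .
qed

end

text \<open>
  The coproduct is multiplicative, so a Leibniz rule for \<open>\<beta>\<close> relative to the counit contraction
  \<open>\<gamma>\<close> makes the contraction with \<open>\<beta>\<close> a derivation. The rule is only required on a set \<open>P\<close> that supports
  the coproducts of the two factors, because functionals will satisfy it on homogeneous elements of a
  subalgebra only.
\<close>

lemma sweedler_derivation: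
  assumes \<beta>: "bilinear_map scale scale \<beta>" and \<gamma>: "bilinear_map scale scale \<gamma>"
    and id: "\<And>x. sweedler scale \<gamma> x = x"
    and x: "\<Delta> x = tens_cls scale f" "Poly_Mapping.keys f \<subseteq> P \<times> P"
    and y: "\<Delta> y = tens_cls scale g" "Poly_Mapping.keys g \<subseteq> P \<times> P"
    and leibniz: "\<And>a b c d. a \<in> P \<Longrightarrow> b \<in> P \<Longrightarrow> c \<in> P \<Longrightarrow> d \<in> P \<Longrightarrow>
      \<beta> (a * c) (b * d) = \<gamma> a b * \<beta> c d + \<beta> a b * \<gamma> c d"
  shows "sweedler scale \<beta> (x * y) = x * sweedler scale \<beta> y + sweedler scale \<beta> x * y"
proof -
  note eq = sweedler_eq[OF vector_space_axioms]
  have inner: "bilinear_map scale scale (\<lambda>c d. \<beta> (a * c) (b * d))" for a b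
    by (rule bilinear_mapI)
      (simp_all add: distrib_left scale_mult_right bilinear_mapD[OF \<beta>])
  have outer: "bilinear_map scale scale (\<lambda>a b. free_lift scale (\<lambda>(c, d). \<beta> (a * c) (b * d)) g)"
    by (rule bilinear_mapI)
      (simp_all add: distrib_right scale_mult_left bilinear_mapD[OF \<beta>] case_prod_unfold
        free_lift_fun_add free_lift_fun_scale)
  have "sweedler scale \<beta> (x * y)
      = free_lift scale (\<lambda>(a, b). free_lift scale (\<lambda>(c, d). \<beta> (a * c) (b * d)) g) f"
    by (simp add: sweedler_mult[OF vector_space_axioms \<beta>] eq[OF inner y(1)] eq[OF outer x(1)])
  also have "\<dots> = free_lift scale (\<lambda>(a, b). free_lift scale
      (\<lambda>(c, d). \<gamma> a b * \<beta> c d + \<beta> a b * \<gamma> c d) g) f"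
    using x(2) y(2) by (intro free_lift_cong) (auto intro!: free_lift_cong leibniz)
  also have "\<dots> = free_lift scale (\<lambda>(a, b). \<gamma> a b) f * free_lift scale (\<lambda>(a, b). \<beta> a b) g
      + free_lift scale (\<lambda>(a, b). \<beta> a b) f * free_lift scale (\<lambda>(a, b). \<gamma> a b) g"
    by (simp add: case_prod_unfold free_lift_fun_add free_lift_mult_left free_lift_mult_right)
  finally show ?thesis
    by (simp add: eq[OF \<beta> x(1), symmetric] eq[OF \<beta> y(1), symmetric]
        eq[OF \<gamma> x(1), symmetric] eq[OF \<gamma> y(1), symmetric] id)
qed

end


section \<open>Derivations with a slice\<close>

context k_algebra
begin

lemma module_homI:
  assumes "\<And>x y. f (x + y) = f x + f y" "\<And>c x. f (scale c x) = scale c (f x)"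
  shows "module_hom scale scale f"
  using assms by (simp add: module_hom_iff module_axioms)

lemma hom_funpow: "module_hom scale scale f \<Longrightarrow> module_hom scale scale (f ^^ k)"
  by (induction k) (auto simp: module_hom_iff)

definition free_over :: "'a set \<Rightarrow> 'a \<Rightarrow> bool" where
  "free_over A z \<longleftrightarrow> (\<forall>c n. (\<forall>i. c i \<in> A) \<longrightarrow> (\<Sum>i\<le>n. c i * z ^ i) = 0 \<longrightarrow> (\<forall>i\<le>n. c i = 0))"

lemma subalgebra_simps:
  assumes "subalgebra scale B"
  shows "subspace B" "1 \<in> B" "\<And>x y. x \<in> B \<Longrightarrow> y \<in> B \<Longrightarrow> x * y \<in> B" "0 \<in> B"
    "\<And>x y. x \<in> B \<Longrightarrow> y \<in> B \<Longrightarrow> x + y \<in> B" "\<And>x y. x \<in> B \<Longrightarrow> y \<in> B \<Longrightarrow> x - y \<in> B"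
    "\<And>c x. x \<in> B \<Longrightarrow> scale c x \<in> B" "\<And>x k. x \<in> B \<Longrightarrow> x ^ k \<in> B"
proof -
  show B: "subspace B" "1 \<in> B" "\<And>x y. x \<in> B \<Longrightarrow> y \<in> B \<Longrightarrow> x * y \<in> B"
    using assms by (auto simp: subalgebra_def)
  show "x ^ k \<in> B" if "x \<in> B" for x k
    by (induction k) (auto intro: B that)
qed (use assms in \<open>auto simp: subalgebra_def subspace_0 subspace_add subspace_diff subspace_scale\<close>)

end

locale derivation_with_slice = k_algebra scale
  for scale :: "'k::field_char_0 \<Rightarrow> 'a::ring_1 \<Rightarrow> 'a" +
  fixes B :: "'a set" and D :: "'a \<Rightarrow> 'a" and z :: 'a
  assumes subalgebra_B: "subalgebra scale B"
    and D_hom: "module_hom scale scale D"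
    and D_closed: "x \<in> B \<Longrightarrow> D x \<in> B"
    and leibniz: "x \<in> B \<Longrightarrow> y \<in> B \<Longrightarrow> D (x * y) = x * D y + D x * y"
    and slice_mem: "z \<in> B" and D_slice: "D z = 1"
begin

sublocale D: module_hom scale scale D by (rule D_hom)

abbreviation constants :: "'a set" where "constants \<equiv> {x \<in> B. D x = 0}"

lemmas B_simps = subalgebra_simps[OF subalgebra_B]

lemma D_one: "D 1 = 0"
  using leibniz[of 1 1] B_simps(2) by simp

lemma subalgebra_constants: "subalgebra scale constants"
  unfolding subalgebra_def subspace_def
  using B_simps by (auto simp: D.add D.scale D_one leibniz)

lemma D_constant_mult: "a \<in> constants \<Longrightarrow> x \<in> B \<Longrightarrow> D (a * x) = a * D x"
  by (simp add: leibniz)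

lemma D_slice_power: "D (z ^ Suc k) = scale (of_nat (Suc k)) (z ^ k)"
proof (induction k)
  case (Suc k)
  have "D (z ^ Suc (Suc k)) = z * D (z ^ Suc k) + z ^ Suc k"
    using leibniz[of z "z ^ Suc k"] slice_mem B_simps(8)[of z "Suc k"] by (simp add: D_slice)
  moreover have "scale (of_nat (Suc (Suc k))) w = w + scale (of_nat (Suc k)) w" for w
    by (simp only: of_nat_Suc[of "Suc k"] scale_left_distrib scale_one)
  ultimately show ?case
    unfolding Suc by (simp add: scale_mult_right add.commute del: of_nat_Suc)
qed (simp add: D_slice)

lemma D_funpow_closed: "x \<in> B \<Longrightarrow> (D ^^ k) x \<in> B"
  by (induction k) (auto intro: D_closed)

lemma funpow_D_zero [simp]: "(D ^^ k) 0 = 0"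
  by (induction k) auto

text \<open>
  Repeated differentiation extracts the leading coefficient of a polynomial in \<open>z\<close>, up to the
  factor \<open>k!\<close>, which is invertible in characteristic \<open>0\<close>. Both the freeness of \<open>B\<close> over the constants and
  the expansion of elements in powers of \<open>z\<close> come from this.
\<close>

lemma funpow_D_monomial:
  assumes a: "a \<in> constants"
  shows "(D ^^ k) (a * z ^ k) = scale (fact k) a"
proof (induction k)
  case (Suc k)
  interpret Dk: module_hom scale scale "D ^^ k" by (rule hom_funpow[OF D_hom])
  have "D (a * z ^ Suc k) = scale (of_nat (Suc k)) (a * z ^ k)"
    using D_constant_mult[OF a, of "z ^ Suc k"] slice_mem B_simps(8)[of z "Suc k"]
    by (simp only: D_slice_power scale_mult_right)
  then show ?case by (simp add: funpow_Suc_right Dk.scale Suc algebra_simps del: funpow.simps of_nat_Suc power_Suc)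
qed simp

lemma funpow_D_monomial_less:
  assumes "a \<in> constants" "i < k"
  shows "(D ^^ k) (a * z ^ i) = 0"
proof -
  obtain j where k: "k = j + Suc i" using \<open>i < k\<close> by (metis add.commute less_imp_Suc_add add_Suc_right)
  interpret Dj: module_hom scale scale "D ^^ j" by (rule hom_funpow[OF D_hom])
  show ?thesis
    unfolding k funpow_add using assms by (simp add: funpow_D_monomial D.scale)
qed

lemma free_over_constants: "free_over constants z"
  unfolding free_over_def
proof (intro allI impI)
  fix c :: "nat \<Rightarrow> 'a" and n i
  assume c: "\<forall>i. c i \<in> constants" and 0: "(\<Sum>i\<le>n. c i * z ^ i) = 0" and "i \<le> n"
  from 0 \<open>i \<le> n\<close> show "c i = 0"
  proof (induction n)
    case (Suc n)
    interpret Dn: module_hom scale scale "D ^^ Suc n" by (rule hom_funpow[OF D_hom])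
    have "(D ^^ Suc n) (\<Sum>i\<le>Suc n. c i * z ^ i) = (\<Sum>i\<le>Suc n. (D ^^ Suc n) (c i * z ^ i))"
      by (rule Dn.sum)
    also have "\<dots> = (D ^^ Suc n) (c (Suc n) * z ^ Suc n) + (\<Sum>i\<le>n. (D ^^ Suc n) (c i * z ^ i))"
      by (simp only: sum.atMost_Suc add.commute)
    also have "(\<Sum>i\<le>n. (D ^^ Suc n) (c i * z ^ i)) = 0"
      using c by (intro sum.neutral ballI funpow_D_monomial_less) auto
    also have "(D ^^ Suc n) (c (Suc n) * z ^ Suc n) = scale (fact (Suc n)) (c (Suc n))"
      using c by (intro funpow_D_monomial) auto
    finally have "c (Suc n) = 0"
      unfolding Suc.prems funpow_D_zero by (simp del: fact_Suc)
    with Suc show ?case by (cases "i = Suc n") auto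
  qed simp
qed

text \<open>
  An element killed by the \<open>k\<close>-th power of \<open>D\<close> is a polynomial of degree less than \<open>k\<close> in \<open>z\<close>: subtracting the
  leading term, found by differentiation, lowers the order of nilpotency. All elements that occur are
  obtained by applying powers of \<open>D\<close> and multiplying by matching powers of \<open>z\<close>, so the coefficients
  remain in every subspace \<open>X\<close> with these closure properties. This is used for \<open>X\<close> a piece of a
  degree filtration.
\<close>

lemma slice_expansion:
  assumes X: "subspace X" "X \<subseteq> B"
    and closed: "\<And>y k. y \<in> X \<Longrightarrow> (D ^^ k) y \<in> X" "\<And>y k. y \<in> X \<Longrightarrow> (D ^^ k) y * z ^ k \<in> X"
    and b: "b \<in> X" "(D ^^ k) b = 0"
  shows "\<exists>c. (\<forall>i. c i \<in> X \<inter> constants) \<and> b = (\<Sum>i<k. c i * z ^ i)"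
  using b
proof (induction k arbitrary: b)
  case 0
  have "0 \<in> X \<inter> constants" using X(1) B_simps(4) by (simp add: subspace_0)
  with 0 show ?case by (intro exI[of _ "\<lambda>_. 0"]) simp
next
  case (Suc k)
  \<comment> \<open>The coefficient of \<open>z ^ k\<close> in \<open>b\<close>.\<close>
  define a where "a = scale (1 / fact k) ((D ^^ k) b)"
  have bB: "b \<in> B" using Suc.prems(1) X(2) by auto
  have a: "a \<in> X \<inter> constants"
    using Suc.prems closed(1)[OF Suc.prems(1), of k] D_funpow_closed[OF bB, of k]
      B_simps(7) subspace_scale[OF X(1)]
    by (auto simp: a_def D.scale)
  have "a * z ^ k \<in> X"
    using closed(2)[OF Suc.prems(1), of k] subspace_scale[OF X(1)] by (simp add: a_def scale_mult_left)
  then have b': "b - a * z ^ k \<in> X"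
    using Suc.prems(1) subspace_diff[OF X(1)] by blast
  interpret Dk: module_hom scale scale "D ^^ k" by (rule hom_funpow[OF D_hom])
  have "(D ^^ k) (b - a * z ^ k) = 0"
    using a by (simp add: Dk.diff funpow_D_monomial) (simp add: a_def)
  from Suc.IH[OF b' this] obtain c where c: "\<forall>i. c i \<in> X \<inter> constants"
    "b - a * z ^ k = (\<Sum>i<k. c i * z ^ i)" by blast
  then have "b = (\<Sum>i<Suc k. (c(k := a)) i * z ^ i)"
    by (simp add: algebra_simps)
  with c(1) a show ?case by (intro exI[of _ "c(k := a)"]) simp
qed

text \<open>
  For constant \<open>a\<close> the derivative of \<open>z a - a z\<close> is \<open>D z \<cdot> a - a \<cdot> D z = a - a\<close>. So \<open>z\<close> normalises the constants
  up to a derivation, with trivial automorphism.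
\<close>

lemma commutator_constant:
  assumes a: "a \<in> constants"
  shows "z * a - a * z \<in> constants"
  using assms B_simps(3,6) slice_mem by (simp add: D.diff leibniz D_slice)

lemma ore_extension_constants:
  assumes nilp: "\<And>b. b \<in> B \<Longrightarrow> \<exists>k. (D ^^ k) b = 0"
  shows "differential_ore_extension scale constants z (\<lambda>a. z * a - a * z) B"
  unfolding ore_extension_def
proof (intro conjI ballI)
  show "algebra_automorphism scale constants (\<lambda>a. a)"
    by (simp add: algebra_automorphism_def bij_betw_def)
  show "skew_derivation scale constants (\<lambda>a. a) (\<lambda>a. z * a - a * z)"
    unfolding skew_derivation_def using commutator_constant
    by (auto simp: algebra_simps scale_mult_left scale_mult_right scale_right_diff_distrib)
  fix b assume b: "b \<in> B"
  from nilp[OF b] obtain k where "(D ^^ k) b = 0" ..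
  with slice_expansion[of B b k] b B_simps(1,3,8) slice_mem D_funpow_closed
  obtain c where c: "\<forall>i. c i \<in> constants" "b = (\<Sum>i<k. c i * z ^ i)" by auto
  show "\<exists>!c. (\<forall>i. c i \<in> constants) \<and> finite {i. c i \<noteq> 0} \<and> b = (\<Sum>i | c i \<noteq> 0. c i * z ^ i)"
  proof (rule ex1I)
    let ?c = "\<lambda>i. if i < k then c i else 0"
    have "finite {i. ?c i \<noteq> 0}" by simp
    moreover have "b = (\<Sum>i | ?c i \<noteq> 0. ?c i * z ^ i)"
      unfolding c(2) by (rule sum.mono_neutral_cong_right) auto
    moreover have "\<forall>i. ?c i \<in> constants" using c(1) B_simps(4) by simp
    ultimately show "(\<forall>i. ?c i \<in> constants) \<and> finite {i. ?c i \<noteq> 0} \<and>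
        b = (\<Sum>i | ?c i \<noteq> 0. ?c i * z ^ i)" by blast
  next
    let ?c = "\<lambda>i. if i < k then c i else 0"
    fix e assume e: "(\<forall>i. e i \<in> constants) \<and> finite {i. e i \<noteq> 0} \<and> b = (\<Sum>i | e i \<noteq> 0. e i * z ^ i)"
    then obtain m where m: "{i. e i \<noteq> 0} \<subseteq> {..m}" by (meson finite_nat_iff_bounded_le)
    let ?n = "max m k"
    have "b = (\<Sum>i\<le>?n. e i * z ^ i)"
      using e m by (auto intro!: sum.mono_neutral_left)
    moreover have "b = (\<Sum>i\<le>?n. ?c i * z ^ i)"
      unfolding c(2) by (rule sum.mono_neutral_cong_left) auto
    ultimately have "(\<Sum>i\<le>?n. (e i - ?c i) * z ^ i) = 0"
      by (simp only: left_diff_distrib sum_subtractf diff_self)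
    moreover have "\<forall>i. e i - ?c i \<in> constants"
      using e c(1) subalgebra_simps(4,6)[OF subalgebra_constants] by simp
    ultimately have *: "\<forall>i\<le>?n. e i - ?c i = 0"
      using free_over_constants[unfolded free_over_def, rule_format, of "\<lambda>i. e i - ?c i" ?n] by blast
    show "e = ?c"
    proof
      fix i show "e i = ?c i"
        using * m by (cases "i \<le> ?n") auto
    qed
  qed
qed (use subalgebra_constants subalgebra_B slice_mem commutator_constant in auto)

text \<open>
  The truncated series \<open>exp (- z D)\<close>, with the powers of \<open>z\<close> written on the right. On elements killed by
  the power \<open>m + 1\<close> of \<open>D\<close> it is the projection onto the constants along the left ideal \<open>B z\<close>.
\<close>

definition constant_part :: "nat \<Rightarrow> 'a \<Rightarrow> 'a" where
  "constant_part m x = (\<Sum>k\<le>m. scale ((-1) ^ k / fact k) ((D ^^ k) x * z ^ k))"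

text \<open>
  In the derivative of the series consecutive terms cancel, and the last one contains the
  vanishing power of \<open>D\<close>.
\<close>

lemma constant_part_in_constants:
  assumes b: "b \<in> B" "(D ^^ Suc m) b = 0"
  shows "constant_part m b \<in> constants"
proof -
  have "constant_part m b \<in> B"
    unfolding constant_part_def
    by (intro subspace_sum[OF B_simps(1)] B_simps(7,3,8) D_funpow_closed b slice_mem)
  moreover have "D (constant_part m b) = scale ((-1) ^ m / fact m) ((D ^^ Suc m) b * z ^ m)" for m
  proof (induction m)
    case (Suc m)
    have "D ((D ^^ Suc m) b * z ^ Suc m)
        = scale (of_nat (Suc m)) ((D ^^ Suc m) b * z ^ m) + (D ^^ Suc (Suc m)) b * z ^ Suc m"
      using leibniz[OF D_funpow_closed[OF b(1)] B_simps(8)[OF slice_mem], of "Suc m" "Suc m"]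
      by (simp only: D_slice_power scale_mult_right funpow.simps comp_def)
    moreover have "(-1) ^ Suc m / fact (Suc m) * (of_nat (Suc m) :: 'k) = - ((-1) ^ m / fact m)"
      by (simp add: field_simps del: of_nat_Suc)
    ultimately have "D (scale ((-1) ^ Suc m / fact (Suc m)) ((D ^^ Suc m) b * z ^ Suc m)) =
       - scale ((-1) ^ m / fact m) ((D ^^ Suc m) b * z ^ m) +
       scale ((-1) ^ Suc m / fact (Suc m)) ((D ^^ Suc (Suc m)) b * z ^ Suc m)"
      by (simp only: D.scale scale_right_distrib scale_scale scale_minus_left)
    moreover have "constant_part (Suc m) b = constant_part m b +
        scale ((-1) ^ Suc m / fact (Suc m)) ((D ^^ Suc m) b * z ^ Suc m)"
      by (simp add: constant_part_def)
    ultimately show ?case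
      by (simp only: D.add Suc) simp
  qed (simp add: constant_part_def)
  ultimately show ?thesis using b by simp
qed

end


section \<open>Bounds for the Gelfand-Kirillov dimension\<close>

lemma const_over_ln_tendsto: "(\<lambda>n. c / ln (real n)) \<longlonglongrightarrow> 0"
  by (rule tendsto_divide_0[OF tendsto_const filterlim_at_top_imp_at_infinity[OF
          filterlim_compose[OF ln_at_top filterlim_real_sequentially]]])

context k_algebra
begin

text \<open>
  The subalgebras \<open>A i\<close> are mere witnesses of freeness, so that the kernels of several unrelated
  derivations can serve in one tower.
\<close>

definition free_tower :: "nat \<Rightarrow> 'a set \<Rightarrow> bool" where
  "free_tower p B \<longleftrightarrow> (\<exists>z A. \<forall>i<p. subalgebra scale (A i) \<and> z i \<in> B \<and> (\<forall>j<i. z j \<in> A i) \<and>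
     free_over (A i) (z i))"

lemma free_tower_Suc:
  assumes "free_tower p A" "A \<subseteq> B" "subalgebra scale A" "z \<in> B" "free_over A z"
  shows "free_tower (Suc p) B"
proof -
  obtain y C where y: "\<forall>i<p. subalgebra scale (C i) \<and> y i \<in> A \<and> (\<forall>j<i. y j \<in> C i) \<and>
     free_over (C i) (y i)" using assms(1) unfolding free_tower_def by blast
  show ?thesis
    unfolding free_tower_def
    by (rule exI[of _ "y(p := z)"], rule exI[of _ "C(p := A)"])
      (use y assms in \<open>auto simp: less_Suc_eq\<close>)
qed

fun monomials :: "(nat \<Rightarrow> 'a) \<Rightarrow> nat \<Rightarrow> nat \<Rightarrow> 'a set" where
  "monomials z 0 n = {1}"
| "monomials z (Suc p) n = (\<lambda>(m, a). m * z p ^ a) ` (monomials z p n \<times> {..n})"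

text \<open>
  A criterion for a finite family that yields injectivity of the indexing along with
  independence of its range, so that the range can be counted.
\<close>

lemma independent_family:
  assumes fin: "finite I"
    and zero: "\<And>u. (\<Sum>i\<in>I. scale (u i) (v i)) = 0 \<Longrightarrow> \<forall>i\<in>I. u i = 0"
  shows "inj_on v I \<and> independent (v ` I)"
proof
  show inj: "inj_on v I"
  proof (rule inj_onI, rule ccontr)
    fix i j assume ij: "i \<in> I" "j \<in> I" "v i = v j" "i \<noteq> j"
    \<comment> \<open>The relation \<open>v i - v j = 0\<close>.\<close>
    let ?u = "\<lambda>l. (if l = i then 1 else 0) - (if l = j then 1 else 0)"
    have "(\<Sum>l\<in>I. scale (?u l) (v l)) =
        (\<Sum>l\<in>I. if l = i then v l else 0) - (\<Sum>l\<in>I. if l = j then v l else 0)"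
      by (simp add: sum_subtractf[symmetric] scale_left_diff_distrib if_distrib[of "\<lambda>c. scale c _"] cong: if_cong)
    also have "\<dots> = 0" using ij fin by simp
    finally show False using zero[of ?u] ij by force
  qed
  show "independent (v ` I)"
  proof (rule independent_if_scalars_zero)
    fix f x assume "(\<Sum>x\<in>v ` I. scale (f x) x) = 0" "x \<in> v ` I"
    then show "f x = 0" using zero[of "f \<circ> v"] by (auto simp: sum.reindex[OF inj])
  qed (use fin in simp)
qed

lemma independent_monomials_step:
  assumes M: "finite M" "independent M" "M \<subseteq> A" and A: "subspace A" and free: "free_over A z"
  shows "inj_on (\<lambda>(m, a). m * z ^ a) (M \<times> {..n}) \<and> independent ((\<lambda>(m, a). m * z ^ a) ` (M \<times> {..n::nat}))"
proof (rule independent_family)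
  fix u assume "(\<Sum>p\<in>M \<times> {..n}. scale (u p) (case p of (m, a) \<Rightarrow> m * z ^ a)) = 0"
  then have "(\<Sum>a\<le>n. \<Sum>m\<in>M. scale (u (m, a)) (m * z ^ a)) = 0"
    by (subst sum.swap) (simp add: sum.cartesian_product case_prod_unfold)
  then have "(\<Sum>a\<le>n. (\<Sum>m\<in>M. scale (u (m, a)) m) * z ^ a) = 0"
    by (simp add: sum_distrib_right scale_mult_left)
  note sum_zero = this
  have mem: "\<forall>a. (\<Sum>m\<in>M. scale (u (m, a)) m) \<in> A"
    using M(3) by (auto intro!: subspace_sum[OF A] subspace_scale[OF A])
  have *: "\<forall>a\<le>n. (\<Sum>m\<in>M. scale (u (m, a)) m) = 0"
    by (rule free[unfolded free_over_def, THEN spec[of _ "\<lambda>a. \<Sum>m\<in>M. scale (u (m, a)) m"],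
          THEN spec[of _ n], THEN mp, THEN mp, OF mem sum_zero])
  have "u (m, a) = 0" if "m \<in> M" "a \<le> n" for m a
    using independentD[OF M(2,1) order_refl, of "\<lambda>m. u (m, a)"] * that by blast
  then show "\<forall>i\<in>M \<times> {..n}. u i = 0" by auto
qed (use M in simp)

lemma monomials_independent:
  assumes "\<forall>i<p. subalgebra scale (A i) \<and> (\<forall>j<i. z j \<in> A i) \<and> free_over (A i) (z i)" "(1::'a) \<noteq> 0"
  shows "finite (monomials z p n) \<and> independent (monomials z p n) \<and> card (monomials z p n) = (n + 1) ^ p"
  using assms(1)
proof (induction p)
  case 0
  then show ?case using assms(2) by simp
next
  case (Suc p)
  have IH: "finite (monomials z p n) \<and> independent (monomials z p n) \<and> card (monomials z p n) = (n + 1) ^ p"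
    using Suc by simp
  have A: "subalgebra scale (A p)" "\<forall>j<p. z j \<in> A p" "free_over (A p) (z p)" using Suc.prems by auto
  have sub: "q \<le> p \<Longrightarrow> monomials z q n \<subseteq> A p" for q
    by (induction q) (use subalgebra_simps(2,3,8)[OF A(1)] A(2) in auto)
  have "inj_on (\<lambda>(m, a). m * z p ^ a) (monomials z p n \<times> {..n}) \<and>
      independent ((\<lambda>(m, a). m * z p ^ a) ` (monomials z p n \<times> {..n}))"
    using IH sub[of p] A subalgebra_simps(1)[OF A(1)] by (intro independent_monomials_step) auto
  with IH show ?case by (simp add: card_image mult.commute)
qed

lemma span_mult:
  assumes "x \<in> span X" "y \<in> span Y" and sub: "\<And>a b. a \<in> X \<Longrightarrow> b \<in> Y \<Longrightarrow> a * b \<in> Z"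
  shows "x * y \<in> span Z"
proof -
  have *: "a * y \<in> span Z" if "a \<in> X" for a
    using assms(2)
  proof (induction rule: span_induct_alt)
    case (step c b w)
    have "scale c (a * b) + a * w \<in> span Z"
      using step that sub by (intro span_add span_scale) (auto intro: span_base)
    then show ?case by (simp add: distrib_left scale_mult_right)
  qed (simp add: span_zero)
  show ?thesis
    using assms(1)
  proof (induction rule: span_induct_alt)
    case (step c a w)
    have "scale c (a * y) + w * y \<in> span Z"
      using step * by (intro span_add span_scale) auto
    then show ?case by (simp add: distrib_right scale_mult_left)
  qed (simp add: span_zero)
qed

abbreviation products :: "nat \<Rightarrow> 'a set \<Rightarrow> 'a set" where
  "products n V \<equiv> {prod_list xs | xs. length xs \<le> n \<and> set xs \<subseteq> V}"

text \<open>
  The powers of a finite-dimensional space are finite-dimensional. This matters since the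
  dimension of an infinite-dimensional space is \<open>0\<close> by convention.
\<close>

lemma products_span: "products n (span F) \<subseteq> span (products n F)"
proof -
  have "prod_list xs \<in> span {prod_list ys | ys. length ys = length xs \<and> set ys \<subseteq> F}"
    if "set xs \<subseteq> span F" for xs
    using that
  proof (induction xs)
    case Nil
    show ?case by (intro span_base) auto
  next
    case (Cons x xs)
    have "x * prod_list xs \<in> span {prod_list ys | ys. length ys = length (x # xs) \<and> set ys \<subseteq> F}"
    proof (rule span_mult)
      show "x \<in> span F" "prod_list xs \<in> span {prod_list ys | ys. length ys = length xs \<and> set ys \<subseteq> F}"
        using Cons by auto
      fix a b assume a: "a \<in> F" and "b \<in> {prod_list ys | ys. length ys = length xs \<and> set ys \<subseteq> F}"
      then obtain ys where "b = prod_list ys" "length ys = length xs" "set ys \<subseteq> F" by blast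
      with a show "a * b \<in> {prod_list ys | ys. length ys = length (x # xs) \<and> set ys \<subseteq> F}"
        by (intro CollectI exI[of _ "a # ys"]) auto
    qed
    then show ?case by simp
  qed
  moreover have "span {prod_list ys | ys. length ys = length xs \<and> set ys \<subseteq> F} \<subseteq> span (products n F)"
    if "length xs \<le> n" for xs :: "'a list"
    using that by (intro span_mono) auto
  ultimately show ?thesis by blast
qed

lemma finite_products: "finite F \<Longrightarrow> finite (products n F)"
  using finite_imageI[OF finite_lists_length_le[of F n], of prod_list]
  by (rule rev_finite_subset) auto

lemma independent_card_le_dim_span:
  assumes "independent M" "M \<subseteq> span X" "X \<subseteq> span F" "finite F"
  shows "card M \<le> dim (span X)"
proof -
  obtain C where C: "C \<subseteq> span X" "independent C" "span X \<subseteq> span C" "card C = dim (span X)"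
    using basis_exists[of "span X"] by metis
  have "span X \<subseteq> span F" using assms(3) by (simp add: span_minimal)
  then have "finite C" using independent_span_bound[OF assms(4) C(2)] C(1) by blast
  from independent_span_bound[OF this assms(1)] assms(2) C show ?thesis by fastforce
qed

lemma monomials_subset_products: "monomials z p n \<subseteq> products (p * n) (span (z ` {..<p}))"
proof -
  have "q \<le> p \<Longrightarrow> monomials z q n \<subseteq> products (q * n) (span (z ` {..<p}))" for q
  proof (induction q)
    case 0
    show ?case by (auto intro!: exI[of _ "[]"])
  next
    case (Suc q)
    show ?case
    proof
      fix x assume "x \<in> monomials z (Suc q) n"
      then obtain m a where x: "x = m * z q ^ a" "m \<in> monomials z q n" "a \<le> n" by auto
      then obtain xs where "m = prod_list xs" "length xs \<le> q * n" "set xs \<subseteq> span (z ` {..<p})"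
        using Suc by fastforce
      moreover have "z q \<in> span (z ` {..<p})" using Suc.prems by (intro span_base) auto
      ultimately show "x \<in> products (Suc q * n) (span (z ` {..<p}))"
        using x by (intro CollectI exI[of _ "xs @ replicate a (z q)"]) (auto simp: prod_list_replicate)
    qed
  qed
  then show ?thesis by simp
qed

text \<open>
  The \<open>(N + 1) ^ p\<close> monomials with exponents at most \<open>N\<close> are products of at most \<open>p N\<close> factors, so the
  dimension of the \<open>n\<close>-th power sum is at least \<open>(n / p) ^ p\<close>. The constant \<open>p\<close> in the denominator disappears
  in the limit of \<open>log\<^sub>n\<close>.
\<close>

lemma free_tower_le_gk_dim:
  assumes "free_tower p UNIV" "(1::'a) \<noteq> 0"
  shows "ereal (real p) \<le> gk_dim scale"
proof -
  obtain z A where zA: "\<forall>i<p. subalgebra scale (A i) \<and> (\<forall>j<i. z j \<in> A i) \<and> free_over (A i) (z i)"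
    using assms(1) unfolding free_tower_def by blast
  define V where "V = span (z ` {..<p})"
  define f where "f n = real (dim (span (products n V)))" for n
  have card: "(N + 1) ^ p \<le> dim (span (products n V))" if "p * N \<le> n" for N n
  proof -
    note M = monomials_independent[OF zA assms(2), of N]
    have "products (p * N) V \<subseteq> products n V" using that order_trans by blast
    then have "monomials z p N \<subseteq> span (products n V)"
      unfolding V_def by (rule order_trans[OF order_trans[OF monomials_subset_products] span_superset])
    moreover have "products n V \<subseteq> span (products n (z ` {..<p}))"
      unfolding V_def by (rule products_span)
    ultimately have "card (monomials z p N) \<le> dim (span (products n V))"
      using M by (intro independent_card_le_dim_span[of _ _ "products n (z ` {..<p})"] finite_products) auto
    with M show ?thesis by simp
  qed
  have lower: "real p - real p * (ln (real p) / ln (real n)) \<le> log (real n) (f n)"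
    if n: "n \<ge> 2" and p: "p \<ge> 1" for n
  proof -
    \<comment> \<open>The largest exponent for which all monomials have at most \<open>n\<close> factors.\<close>
    let ?N = "n div p"
    have "n < p * (?N + 1)"
      using p dividend_less_times_div[of p n] by (simp add: algebra_simps)
    then have "real n < real p * real (?N + 1)"
      by (metis of_nat_less_iff of_nat_mult)
    then have "real n / real p \<le> real (?N + 1)" using p by (simp add: field_simps)
    then have "(real n / real p) ^ p \<le> real (?N + 1) ^ p"
      by (intro power_mono) auto
    also have "\<dots> \<le> f n"
      unfolding f_def of_nat_power[symmetric] of_nat_le_iff by (rule card) simp
    finally have le: "(real n / real p) ^ p \<le> f n" .
    have "log (real n) ((real n / real p) ^ p) = real p * (1 - log (real n) (real p))"
      using n p by (subst log_nat_power) (simp_all add: log_divide)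
    also have "\<dots> = real p - real p * (ln (real p) / ln (real n))"
      by (simp add: log_def algebra_simps)
    finally show ?thesis
      using log_mono[OF _ _ le, of "real n"] n p by simp
  qed
  have "ereal (real p) \<le> limsup (\<lambda>n. ereal (log (real n) (f n)))"
  proof (cases "p = 0")
    case True
    have "\<forall>n\<ge>2. 0 \<le> ereal (log (real n) (f n))"
    proof (intro allI impI)
      fix n :: nat assume n: "2 \<le> n"
      have "1 \<le> f n" using card[of 0 n] True unfolding f_def by simp
      then show "0 \<le> ereal (log (real n) (f n))" using n by simp
    qed
    then have "(\<forall>\<^sub>F n in sequentially. ereal 0 \<le> ereal (log (real n) (f n)))"
      by (auto simp: eventually_sequentially)
    from Limsup_mono[OF this] show ?thesis
      using True by (simp add: Limsup_const)
  next
    case False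
    have "((\<lambda>n. real p - real p * (ln (real p) / ln (real n))) \<longlongrightarrow> real p - real p * 0) sequentially"
      by (intro tendsto_intros const_over_ln_tendsto)
    then have "((\<lambda>n. ereal (real p - real p * (ln (real p) / ln (real n)))) \<longlongrightarrow> ereal (real p)) sequentially"
      by simp
    then have "limsup (\<lambda>n. ereal (real p - real p * (ln (real p) / ln (real n)))) = ereal (real p)"
      by (intro lim_imp_Limsup) auto
    moreover have "limsup (\<lambda>n. ereal (real p - real p * (ln (real p) / ln (real n))))
       \<le> limsup (\<lambda>n. ereal (log (real n) (f n)))"
    proof (rule Limsup_mono, unfold eventually_sequentially, rule exI[of _ 2], intro allI impI)
      fix n :: nat assume "2 \<le> n"
      with lower[of n] False show "ereal (real p - real p * (ln (real p) / ln (real n)))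
        \<le> ereal (log (real n) (f n))" by simp
    qed
    ultimately show ?thesis by simp
  qed
  also have "\<dots> \<le> gk_dim scale"
    unfolding gk_dim_def f_def by (rule SUP_upper2[of V]) (auto simp: V_def)
  finally show ?thesis .
qed

text \<open>
  A finite-dimensional space lies in some filtration step \<open>F N\<close>, so its products of at most \<open>n\<close> factors lie
  in \<open>F (N n)\<close>, whose dimension is at most \<open>(N n + 1) ^ d\<close>. Again \<open>N\<close> disappears in the limit.
\<close>

lemma gk_dim_le:
  fixes F :: "nat \<Rightarrow> 'a set"
  assumes F: "\<And>m. subspace (F m)" "\<And>m n x. x \<in> F m \<Longrightarrow> m \<le> n \<Longrightarrow> x \<in> F n" "\<And>x. \<exists>m. x \<in> F m"
    and one: "1 \<in> F 0" and mult: "\<And>m n x y. x \<in> F m \<Longrightarrow> y \<in> F n \<Longrightarrow> x * y \<in> F (m + n)"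
    and bound: "\<And>m. \<exists>X. finite X \<and> card X \<le> (m + 1) ^ d \<and> F m \<subseteq> span X"
  shows "gk_dim scale \<le> ereal (real d)"
  unfolding gk_dim_def
proof (rule SUP_least)
  fix V assume "V \<in> {span E | E. finite E}"
  then obtain E where E: "V = span E" "finite E" by blast
  obtain N where N: "N \<ge> 1" "E \<subseteq> F N"
  proof -
    have "\<exists>N\<ge>1. E \<subseteq> F N" using E(2)
    proof (induction E rule: finite_induct)
      case (insert x E)
      then obtain N m where "N \<ge> 1" "E \<subseteq> F N" "x \<in> F m" using F(3) by blast
      then have "max N m \<ge> 1 \<and> insert x E \<subseteq> F (max N m)" using F(2) by fastforce
      then show ?case by blast
    qed auto
    with that show ?thesis by blast
  qed
  have VN: "V \<subseteq> F N" unfolding E(1) by (rule span_minimal[OF N(2) F(1)])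
  have prod: "set xs \<subseteq> V \<Longrightarrow> prod_list xs \<in> F (N * length xs)" for xs
    by (induction xs) (use one mult[of _ N] VN in auto)
  have dim: "dim (span (products n V)) \<le> (N * n + 1) ^ d" for n
  proof -
    obtain X where X: "finite X" "card X \<le> (N * n + 1) ^ d" "F (N * n) \<subseteq> span X" using bound by blast
    have "products n V \<subseteq> F (N * n)"
      using prod F(2) by (fastforce intro: mult_le_mono2)
    then have "span (products n V) \<subseteq> span X" using X(3) by (intro span_minimal) auto
    from dim_le_card[OF this X(1)] X(2) show ?thesis by simp
  qed
  \<comment> \<open>The logarithm to base \<open>n\<close> of \<open>(2 N n) ^ d\<close>, which is at least \<open>(N n + 1) ^ d\<close>.\<close>
  let ?g = "\<lambda>n. real d * (ln (2 * real N) / ln (real n) + 1)"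
  have upper: "log (real n) (real (dim (span (products n V)))) \<le> ?g n" if n: "n \<ge> 2" for n
  proof (cases "dim (span (products n V)) = 0")
    case True
    have "0 \<le> ?g n" using n N(1) by (intro mult_nonneg_nonneg add_nonneg_nonneg divide_nonneg_nonneg) auto
    with True show ?thesis by (simp add: log_def)
  next
    case False
    have "N * n + 1 \<le> 2 * N * n" using N(1) n by (simp add: Suc_leI)
    then have "dim (span (products n V)) \<le> (2 * N * n) ^ d"
      using dim[of n] power_mono[of "N * n + 1" "2 * N * n" d] by linarith
    then have "real (dim (span (products n V))) \<le> (2 * real N * real n) ^ d"
      by (metis (mono_tags, lifting) of_nat_le_iff of_nat_mult of_nat_numeral of_nat_power)
    then have "log (real n) (real (dim (span (products n V)))) \<le> log (real n) ((2 * real N * real n) ^ d)"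
      using False n by (intro log_mono) auto
    also have "\<dots> = real d * log (real n) (2 * real N * real n)"
      using n N(1) by (intro log_nat_power) auto
    also have "log (real n) (2 * real N * real n) = ln (2 * real N) / ln (real n) + 1"
      using n N(1) by (simp add: log_def ln_mult add_divide_distrib)
    finally show ?thesis .
  qed
  have "(?g \<longlongrightarrow> real d * (0 + 1)) sequentially"
    by (intro tendsto_intros const_over_ln_tendsto)
  then have "((\<lambda>n. ereal (?g n)) \<longlongrightarrow> ereal (real d)) sequentially"
    by simp
  then have "limsup (\<lambda>n. ereal (?g n)) = ereal (real d)"
    by (intro lim_imp_Limsup) auto
  moreover have "limsup (\<lambda>n. ereal (log (real n) (real (dim (span (products n V)))))) \<le> limsup (\<lambda>n. ereal (?g n))"
    by (rule Limsup_mono, unfold eventually_sequentially, rule exI[of _ 2]) (use upper in auto)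
  ultimately show "limsup (\<lambda>n. ereal (log (real n) (real (dim (span (products n V)))))) \<le> ereal (real d)"
    by simp
qed

end


section \<open>Homogeneous components\<close>

context graded_hopf_algebra
begin

definition component :: "nat \<Rightarrow> 'h \<Rightarrow> 'h" where
  "component n x = (THE f. (\<forall>n. f n \<in> H n) \<and> finite {n. f n \<noteq> 0} \<and> x = (\<Sum>n | f n \<noteq> 0. f n)) n"

lemma component_in: "component n x \<in> H n"
  and finite_components: "finite {n. component n x \<noteq> 0}"
  and sum_components: "x = (\<Sum>n | component n x \<noteq> 0. component n x)"
  using theI'[OF grade_direct_sum[of x]] unfolding component_def[abs_def] by blast+

lemma component_sum:
  assumes "\<And>n. f n \<in> H n" "finite A" "\<And>n. n \<notin> A \<Longrightarrow> f n = 0"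
  shows "component n (\<Sum>i\<in>A. f i) = f n"
proof -
  have sub: "{n. f n \<noteq> 0} \<subseteq> A" using assms(3) by auto
  moreover have "(\<Sum>i\<in>A. f i) = (\<Sum>n | f n \<noteq> 0. f n)"
    using sub assms(2) by (intro sum.mono_neutral_right) auto
  ultimately have "(THE g. (\<forall>n. g n \<in> H n) \<and> finite {n. g n \<noteq> 0} \<and> (\<Sum>i\<in>A. f i) = (\<Sum>n | g n \<noteq> 0. g n)) = f"
    using assms finite_subset by (intro the1_equality[OF grade_direct_sum]) blast
  then show ?thesis by (simp add: component_def)
qed

lemma sum_components_superset:
  "finite A \<Longrightarrow> (\<And>n. n \<notin> A \<Longrightarrow> component n x = 0) \<Longrightarrow> (\<Sum>n\<in>A. component n x) = x"
  by (subst (3) sum_components) (auto intro!: sum.mono_neutral_right)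

lemma component_hom: "module_hom scale scale (component n)"
proof (rule module_homI)
  fix x y
  let ?A = "{n. component n x \<noteq> 0} \<union> {n. component n y \<noteq> 0}"
  have "x + y = (\<Sum>n\<in>?A. component n x + component n y)"
    unfolding sum.distrib by (subst (1 2) sum_components_superset) (auto simp: finite_components)
  then show "component n (x + y) = component n x + component n y"
    using component_sum[of "\<lambda>n. component n x + component n y" ?A n]
    by (simp add: component_in finite_components grade_subspace subspace_add)
next
  fix c x
  let ?A = "{n. component n x \<noteq> 0}"
  have "scale c x = (\<Sum>n\<in>?A. scale c (component n x))"
    by (simp add: scale_sum_right[symmetric] sum_components[symmetric])
  then show "component n (scale c x) = scale c (component n x)"
    using component_sum[of "\<lambda>n. scale c (component n x)" ?A n]
    by (simp add: component_in finite_components grade_subspace subspace_scale)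
qed

sublocale component: module_hom scale scale "component n" for n by (rule component_hom)

lemma component_homogeneous: "x \<in> H m \<Longrightarrow> component n x = (if n = m then x else 0)"
  using component_sum[of "\<lambda>i. if i = m then x else 0" "{m}" n]
  by (simp add: grade_subspace subspace_0)

definition filt :: "nat \<Rightarrow> 'h set" where
  "filt m = {x. \<forall>j>m. component j x = 0}"

lemma subspace_filt: "subspace (filt m)"
  by (simp add: subspace_def filt_def component.add component.scale)

lemma filt_mono: "x \<in> filt m \<Longrightarrow> m \<le> n \<Longrightarrow> x \<in> filt n"
  by (simp add: filt_def)

lemma homogeneous_in_filt: "x \<in> H m \<Longrightarrow> x \<in> filt m"
  by (simp add: filt_def component_homogeneous)

lemma filt_sum: "x \<in> filt m \<Longrightarrow> (\<Sum>j\<le>m. component j x) = x"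
  by (rule sum_components_superset) (auto simp: filt_def)

lemma filt_exhaust: "\<exists>m. x \<in> filt m"
proof -
  obtain m where "{n. component n x \<noteq> 0} \<subseteq> {..m}"
    using finite_components by (meson finite_nat_iff_bounded_le)
  then have "x \<in> filt m" by (force simp: filt_def)
  then show ?thesis ..
qed

lemma filt_mult:
  assumes "x \<in> filt m" "y \<in> filt n"
  shows "x * y \<in> filt (m + n)"
proof -
  have "x * y = (\<Sum>i\<le>m. \<Sum>j\<le>n. component i x * component j y)"
    by (simp add: filt_sum[OF assms(1)] filt_sum[OF assms(2)] flip: sum_product)
  also have "\<dots> \<in> filt (m + n)"
    by (intro subspace_sum[OF subspace_filt]
        filt_mono[OF homogeneous_in_filt[OF grade_mult[OF component_in component_in]]]) auto
  finally show ?thesis .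
qed

lemma grade_power: "z \<in> H n \<Longrightarrow> z ^ k \<in> H (k * n)"
  by (induction k) (auto intro: grade_one grade_mult)

lemma one_neq_zero: "(1::'h) \<noteq> 0"
  using counit_one counit_scale[of 0 0] by auto

lemma counit_hom: "module_hom scale (*) \<epsilon>"
  by (simp add: module_hom_iff module_axioms counit_add counit_scale) (unfold_locales; simp add: algebra_simps)

abbreviation pairs :: "'h set \<Rightarrow> nat \<Rightarrow> ('h \<times> 'h) set" where
  "pairs B n \<equiv> \<Union>(i, j)\<in>{(i, j). i + j = n}. (B \<inter> H i) \<times> (B \<inter> H j)"

abbreviation positive_pairs :: "'h set \<Rightarrow> nat \<Rightarrow> ('h \<times> 'h) set" where
  "positive_pairs B n \<equiv> \<Union>(i, j)\<in>{(i, j). i > 0 \<and> j > 0 \<and> i + j = n}. (B \<inter> H i) \<times> (B \<inter> H j)"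

text \<open>
  For a connected grading this makes \<open>B\<close> a graded Hopf subalgebra: closure under the antipode follows
  from the conditions on products and coproducts (\<open>graded_hopf_subalgebra_if_subbialgebra\<close>).
\<close>

definition graded_subbialgebra :: "'h set \<Rightarrow> bool" where
  "graded_subbialgebra B \<longleftrightarrow> subalgebra scale B \<and> (\<forall>x\<in>B. \<forall>n. component n x \<in> B) \<and>
     (\<forall>n. \<forall>x\<in>B \<inter> H n. \<Delta> x \<in> tens_span scale (pairs B n))"

lemma graded_subbialgebra_UNIV: "graded_subbialgebra UNIV"
  using grade_comult by (auto simp: graded_subbialgebra_def subalgebra_def)

lemma homogeneous_representative:
  assumes B: "graded_subbialgebra B" and x: "x \<in> B"
  shows "\<exists>f. Poly_Mapping.keys f \<subseteq> (\<Union>i. B \<inter> H i) \<times> (\<Union>i. B \<inter> H i) \<and> \<Delta> x = tens_cls scale f"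
proof -
  interpret cop: module_hom scale free_scale cop by (rule cop_hom)
  let ?A = "{n. component n x \<noteq> 0}"
  have "\<forall>n. \<exists>f. Poly_Mapping.keys f \<subseteq> pairs B n \<and> \<Delta> (component n x) = tens_cls scale f"
    using B x component_in unfolding graded_subbialgebra_def tens_span_iff by blast
  then obtain f where f: "\<And>n. Poly_Mapping.keys (f n) \<subseteq> pairs B n"
    "\<And>n. \<Delta> (component n x) = tens_cls scale (f n)" by metis
  have "cop x = (\<Sum>n\<in>?A. cop (component n x))"
    by (subst sum_components) (rule cop.sum)
  also have "\<dots> = tval (\<Sum>n\<in>?A. f n)"
    using f(2) by (simp add: comult_eq_iff free.free_lift_sum)
  finally have "\<Delta> x = tens_cls scale (\<Sum>n\<in>?A. f n)" by (simp add: comult_eq_iff)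
  moreover have "Poly_Mapping.keys (\<Sum>n\<in>?A. f n) \<subseteq> (\<Union>n. Poly_Mapping.keys (f n))"
    by (rule order_trans[OF Poly_Mapping.keys_sum]) auto
  moreover have "pairs B n \<subseteq> (\<Union>i. B \<inter> H i) \<times> (\<Union>i. B \<inter> H i)" for n by auto
  ultimately show ?thesis using f(1) by blast
qed

end


section \<open>Connected gradings: reduced coproducts and antipodes\<close>

context connected_graded_hopf_algebra
begin

lemma degree_zero_scalar:
  assumes "x \<in> H 0"
  shows "\<exists>c. x = scale c 1"
proof -
  obtain C where C: "C \<subseteq> H 0" "independent C" "H 0 \<subseteq> span C" "card C = dim (H 0)"
    by (rule basis_exists[of "H 0"])
  then obtain b where b: "C = {b}" using connected by (metis card_1_singletonE)
  have "1 \<in> range (\<lambda>c. scale c b)" "x \<in> range (\<lambda>c. scale c b)"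
    using C(3) b grade_one assms by (auto simp: span_singleton)
  then obtain c d where c: "1 = scale c b" and d: "x = scale d b" by blast
  have "c \<noteq> 0" using c one_neq_zero by auto
  then have "x = scale (d / c) 1" unfolding d by (subst c) simp
  then show ?thesis ..
qed

text \<open>
  Homogeneous elements of degree \<open>0\<close> are scalars, so the outer terms of the coproduct combine to
  \<open>1 \<otimes> u + v \<otimes> 1\<close>. The counit kills the middle terms and identifies both \<open>u\<close> and \<open>v\<close> with \<open>x\<close>.
\<close>

lemma reduced_coproduct:
  assumes B: "graded_subbialgebra B" and x: "x \<in> B" "x \<in> H m" and "m > 0"
  shows "\<exists>g. Poly_Mapping.keys g \<subseteq> positive_pairs B m \<and>
    \<Delta> x = tens_cls scale (Poly_Mapping.single (1, x) 1 + Poly_Mapping.single (x, 1) 1 + g)"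
proof -
  let ?T = "\<lambda>u v g. Poly_Mapping.single (1, u) 1 + Poly_Mapping.single (v, 1) 1 + g"
  have BH: "subspace (B \<inter> H m)"
    using B grade_subspace by (auto simp: graded_subbialgebra_def subalgebra_def intro: subspace_inter)
  have z: "tprod a 0 = 0" "tprod 0 a = 0" for a
    using tprod_simps(3)[of 0 0 a] tprod_simps(4)[of a 0 0] by simp_all
  obtain f where f: "Poly_Mapping.keys f \<subseteq> pairs B m" "\<Delta> x = tens_cls scale f"
    using B x unfolding graded_subbialgebra_def tens_span_iff by blast
  from f(1) have "\<exists>u v g. u \<in> B \<inter> H m \<and> v \<in> B \<inter> H m \<and> Poly_Mapping.keys g \<subseteq> positive_pairs B m \<and>
     tval f = tval (?T u v g)"
    unfolding keys_subset_iff_free_span[of f]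
  proof (induction rule: free.span_induct_alt)
    case base
    show ?case
      by (rule exI[of _ 0], rule exI[of _ 0], rule exI[of _ 0])
        (use subspace_0[OF BH] in \<open>simp add: free.free_lift_add z\<close>)
  next
    case (step c p y)
    then obtain u v g where IH: "u \<in> B \<inter> H m" "v \<in> B \<inter> H m"
      "Poly_Mapping.keys g \<subseteq> positive_pairs B m" "tval y = tval (?T u v g)" by blast
    from step obtain a b i j where p: "p = Poly_Mapping.single (a, b) 1" "a \<in> B" "a \<in> H i" "b \<in> B" "b \<in> H j"
      "i + j = m" by blast
    have eq: "tval (free_scale c p + y) = free_scale c (tprod a b) + tval (?T u v g)"
      by (simp add: free.free_lift_add free.free_lift_scale p(1) IH(4))
    consider "i = 0" | "j = 0" | "i > 0" "j > 0" by auto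
    then show ?case
    proof cases
      case 1
      then obtain l where l: "a = scale l 1" using degree_zero_scalar p by blast
      show ?thesis
        by (rule exI[of _ "u + scale (c * l) b"], rule exI[of _ v], rule exI[of _ g])
          (use IH 1 p in \<open>simp add: eq subspace_add[OF BH, simplified] subspace_scale[OF BH, simplified]
            free.free_lift_add free.free_lift_scale tprod_simps l\<close>)
    next
      case 2
      then obtain l where l: "b = scale l 1" using degree_zero_scalar p by blast
      show ?thesis
        by (rule exI[of _ u], rule exI[of _ "v + scale (c * l) a"], rule exI[of _ g])
          (use IH 2 p in \<open>simp add: eq subspace_add[OF BH, simplified] subspace_scale[OF BH, simplified]
            free.free_lift_add free.free_lift_scale tprod_simps l\<close>)
    next
      case 3
      have "Poly_Mapping.keys (free_scale c p + g) \<subseteq> {(a, b)} \<union> Poly_Mapping.keys g"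
        using Poly_Mapping.keys_add[of "free_scale c p" g]
        by (auto simp: p(1) in_keys_iff lookup_single when_def split: if_splits)
      moreover have "(a, b) \<in> positive_pairs B m" using p 3 by blast
      ultimately have "Poly_Mapping.keys (free_scale c p + g) \<subseteq> positive_pairs B m"
        using IH(3) by blast
      then show ?thesis
        by (intro exI[of _ u] exI[of _ v] exI[of _ "free_scale c p + g"])
          (use IH in \<open>simp add: eq free.free_lift_add free.free_lift_scale p(1)\<close>)
    qed
  qed
  then obtain u v g where uvg: "u \<in> H m" "v \<in> H m" "Poly_Mapping.keys g \<subseteq> positive_pairs B m"
    "tval f = tval (?T u v g)" by blast
  have \<Delta>x: "\<Delta> x = tens_cls scale (?T u v g)"
    using f(2) uvg(4) by (simp add: tens_cls_eq_iff_tval)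
  have zero: "\<epsilon> a = 0 \<and> \<epsilon> b = 0" if "(a, b) \<in> Poly_Mapping.keys g" for a b
    using that uvg(3) grade_counit by blast
  have "free_lift scale (\<lambda>(a, b). scale (\<epsilon> a) b) g \<in> {0}"
    "free_lift scale (\<lambda>(a, b). scale (\<epsilon> b) a) g \<in> {0}"
    by (rule free_lift_in_subspace, simp, use zero in force)+
  moreover have "contract_left \<epsilon> x = x" "contract_right \<epsilon> x = x"
    by (simp_all add: contract_left_def contract_right_def sweedler_counit_left sweedler_counit_right)
  ultimately have "x = u" "x = v"
    using contract_left_eq[OF counit_hom \<Delta>x] contract_right_eq[OF counit_hom \<Delta>x] uvg(1,2) \<open>m > 0\<close>
    by (simp_all add: free_lift_add counit_one grade_counit)
  with uvg \<Delta>x show ?thesis by blast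
qed

text \<open>
  In positive degree, \<open>S x = - x - \<Sum> S(x') x''\<close> over the middle terms \<open>x' \<otimes> x''\<close> of the coproduct, which
  determines \<open>S\<close> by recursion on the degree.
\<close>

lemma antipode_closed:
  assumes B: "graded_subbialgebra B" and x: "x \<in> B"
  shows "S x \<in> B"
proof -
  note B_simps = subalgebra_simps[OF B[unfolded graded_subbialgebra_def, THEN conjunct1]]
  have S: "module_hom scale scale S" by (rule module_homI) (simp_all add: antipode_add antipode_scale)
  have bil: "bilinear_map scale scale (\<lambda>a b. S a * b)"
    by (rule bilinear_mapI)
      (simp_all add: antipode_add antipode_scale distrib_left distrib_right scale_mult_left scale_mult_right)
  note antipode_eq = sweedler_eq[OF vector_space_axioms bil, unfolded sweedler_antipode]
  have S1: "S 1 = 1"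
    using antipode_eq[OF comult_one[unfolded tens_pure_def]] by (simp add: counit_one)
  have hom: "S x \<in> B" if "x \<in> B" "x \<in> H m" for x m
    using that
  proof (induction m arbitrary: x rule: less_induct)
    case (less m)
    show ?case
    proof (cases "m = 0")
      case True
      with less.prems degree_zero_scalar obtain c where "x = scale c 1" by blast
      then show ?thesis using B_simps by (simp add: antipode_scale S1)
    next
      case False
      then obtain g where g: "Poly_Mapping.keys g \<subseteq> positive_pairs B m"
        "\<Delta> x = tens_cls scale (Poly_Mapping.single (1, x) 1 + Poly_Mapping.single (x, 1) 1 + g)"
        using reduced_coproduct[OF B less.prems] by blast
      have "free_lift scale (\<lambda>(a, b). S a * b) g \<in> B"
      proof (rule free_lift_in_subspace[OF B_simps(1)])
        fix p assume "p \<in> Poly_Mapping.keys g"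
        then obtain a b i j where "p = (a, b)" "a \<in> B" "a \<in> H i" "b \<in> B" "i < m" using g(1) by fastforce
        then show "(case p of (a, b) \<Rightarrow> S a * b) \<in> B" using less.IH[of i a] B_simps(3) by simp
      qed
      moreover have "0 = x + S x + free_lift scale (\<lambda>(a, b). S a * b) g"
        using antipode_eq[OF g(2)] less.prems False
        by (simp add: free_lift_add S1 grade_counit)
      then have "S x = - x - free_lift scale (\<lambda>(a, b). S a * b) g" by (simp add: algebra_simps eq_neg_iff_add_eq_0)
      ultimately show ?thesis using less.prems B_simps(6)[OF B_simps(6)[OF B_simps(4)]] by fastforce
    qed
  qed
  have "S x = (\<Sum>n | component n x \<noteq> 0. S (component n x))"
    by (subst sum_components) (rule module_hom.sum[OF S])
  then show ?thesis
    using hom[OF _ component_in] B x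
    by (auto simp: graded_subbialgebra_def intro!: subspace_sum[OF B_simps(1)])
qed

lemma graded_hopf_subalgebra_if_subbialgebra:
  assumes B: "graded_subbialgebra B"
  shows "graded_hopf_subalgebra scale \<Delta> S H B"
proof -
  note B_simps = subalgebra_simps[OF B[unfolded graded_subbialgebra_def, THEN conjunct1]]
  have "\<Delta> x \<in> tens_span scale (B \<times> B)" if "x \<in> B" for x
    using homogeneous_representative[OF B that] unfolding tens_span_iff by blast
  moreover have "B \<subseteq> span (\<Union>n. B \<inter> H n)"
  proof
    fix x assume x: "x \<in> B"
    have "(\<Sum>n | component n x \<noteq> 0. component n x) \<in> span (\<Union>n. B \<inter> H n)"
      using B x component_in by (intro span_sum span_base) (auto simp: graded_subbialgebra_def)
    then show "x \<in> span (\<Union>n. B \<inter> H n)" by (simp flip: sum_components)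
  qed
  moreover have "span (\<Union>n. B \<inter> H n) \<subseteq> B" by (rule span_minimal) (use B_simps in auto)
  ultimately show ?thesis
    using B antipode_closed[OF B]
    by (auto simp: graded_hopf_subalgebra_def hopf_subalgebra_def graded_subbialgebra_def)
qed

end


section \<open>Point derivations\<close>

text \<open>
  The coordinate of \<open>z\<close> in a basis that contains \<open>z\<close> and a basis of \<open>U\<close>.
\<close>

lemma (in vector_space) separating_functional:
  assumes U: "subspace U" and z: "z \<notin> U"
  shows "\<exists>\<phi>. module_hom scale (*) \<phi> \<and> \<phi> z = 1 \<and> (\<forall>u\<in>U. \<phi> u = 0)"
proof -
  obtain C where C: "C \<subseteq> U" "independent C" "U \<subseteq> span C" by (rule basis_exists[of U])
  then have "span C \<subseteq> U" using U by (simp add: span_minimal)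
  with z have zC: "z \<notin> span C" by auto
  then have "independent (insert z C)" using C(2) by (rule independent_insertI)
  let ?E = "extend_basis (insert z C)"
  have E: "independent ?E" "insert z C \<subseteq> ?E" "span ?E = UNIV"
    using independent_extend_basis extend_basis_superset span_extend_basis \<open>independent (insert z C)\<close>
    by blast+
  define \<phi> where "\<phi> v = representation ?E v z" for v
  have \<phi>: "module_hom scale (*) \<phi>"
    unfolding \<phi>_def using linear_representation[OF E(1,3), of z]
    by (simp add: module_hom_iff_linear)
  then interpret \<phi>: module_hom scale "(*)" \<phi> .
  have "\<phi> u = 0" if "u \<in> U" for u
  proof -
    have "u \<in> span C" using that C(3) by auto
    then show ?thesis
    proof (induction rule: span_induct_alt)
      case (step c x y)
      moreover have "x \<noteq> z" using step zC span_base by auto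
      ultimately show ?case
        using E by (auto simp: \<phi>.add \<phi>.scale) (simp add: \<phi>_def representation_basis subset_iff)
    qed simp
  qed
  moreover have "\<phi> z = 1" using E by (simp add: \<phi>_def representation_basis)
  ultimately show ?thesis using \<phi> by blast
qed

context connected_graded_hopf_algebra
begin

definition decomposables :: "'h set \<Rightarrow> nat \<Rightarrow> 'h set" where
  "decomposables B n = span {x * y | x y i j. x \<in> B \<inter> H i \<and> y \<in> B \<inter> H j \<and> i > 0 \<and> j > 0 \<and> i + j = n}"

text \<open>
  The degrees of the elements of a minimal homogeneous generating set.
\<close>

definition generator_degrees :: "'h set \<Rightarrow> nat set" where
  "generator_degrees B = {n. n > 0 \<and> \<not> B \<inter> H n \<subseteq> decomposables B n}"

text \<open>
  A homogeneous functional of degree \<open>n\<close> that vanishes on products of elements of \<open>B\<close> of positive degree.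
  Equivalently, on \<open>B\<close> it is a derivation into the base field regarded as a module via the counit
  (\<open>point_derivation_mult\<close>).
\<close>

definition point_derivation :: "'h set \<Rightarrow> nat \<Rightarrow> ('h \<Rightarrow> 'k) \<Rightarrow> bool" where
  "point_derivation B n \<xi> \<longleftrightarrow> n > 0 \<and> module_hom scale (*) \<xi> \<and>
     (\<forall>j x. x \<in> H j \<longrightarrow> j \<noteq> n \<longrightarrow> \<xi> x = 0) \<and>
     (\<forall>i j x y. x \<in> B \<inter> H i \<longrightarrow> y \<in> B \<inter> H j \<longrightarrow> i > 0 \<longrightarrow> j > 0 \<longrightarrow> \<xi> (x * y) = 0)"

lemma point_derivation_exists:
  assumes "n \<in> generator_degrees B"
  shows "\<exists>z \<xi>. z \<in> B \<inter> H n \<and> point_derivation B n \<xi> \<and> \<xi> z = 1"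
proof -
  obtain z where z: "z \<in> B \<inter> H n" "z \<notin> decomposables B n" and n: "n > 0"
    using assms unfolding generator_degrees_def by blast
  obtain \<phi> where \<phi>: "module_hom scale (*) \<phi>" "\<phi> z = 1" "\<forall>u\<in>decomposables B n. \<phi> u = 0"
    using separating_functional[OF _ z(2)] unfolding decomposables_def by auto
  interpret \<phi>: module_hom scale "(*)" \<phi> by fact
  \<comment> \<open>Projecting to degree \<open>n\<close> first makes the functional homogeneous.\<close>
  let ?\<xi> = "\<lambda>x. \<phi> (component n x)"
  have "module_hom scale (*) ?\<xi>"
    using \<phi>(1) by (simp add: module_hom_iff component.add component.scale)
  moreover have "?\<xi> (x * y) = 0" if xy: "x \<in> B \<inter> H i" "y \<in> B \<inter> H j" "i > 0" "j > 0" for i j x y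
  proof (cases "i + j = n")
    case True
    then have "x * y \<in> decomposables B n"
      unfolding decomposables_def by (intro span_base) (use xy in blast)
    moreover have "x * y \<in> H n" using True xy grade_mult by auto
    ultimately show ?thesis using \<phi>(3) by (simp add: component_homogeneous)
  next
    case False
    moreover have "x * y \<in> H (i + j)" using xy grade_mult by auto
    ultimately show ?thesis by (simp add: component_homogeneous)
  qed
  ultimately have "point_derivation B n ?\<xi>"
    using n by (auto simp: point_derivation_def component_homogeneous)
  moreover have "?\<xi> z = 1" using z \<phi>(2) by (simp add: component_homogeneous[of z n])
  ultimately show ?thesis using z(1) by blast
qed

context
  fixes B n \<xi>
  assumes B: "graded_subbialgebra B" and \<xi>: "point_derivation B n \<xi>"
begin

lemma point_derivation_hom: "module_hom scale (*) \<xi>"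
  using \<xi> by (simp add: point_derivation_def)

lemma point_derivation_other_degree: "x \<in> H j \<Longrightarrow> j \<noteq> n \<Longrightarrow> \<xi> x = 0"
  using \<xi> by (simp add: point_derivation_def)

lemma point_derivation_mult:
  assumes "a \<in> (\<Union>i. B \<inter> H i)" "b \<in> (\<Union>i. B \<inter> H i)"
  shows "\<xi> (a * b) = \<epsilon> a * \<xi> b + \<xi> a * \<epsilon> b"
proof -
  interpret \<xi>: module_hom scale "(*)" \<xi> by (rule point_derivation_hom)
  obtain i j where ij: "a \<in> B" "a \<in> H i" "b \<in> B" "b \<in> H j" using assms by blast
  have n: "n > 0" using \<xi> by (simp add: point_derivation_def)
  consider "i = 0" | "j = 0" | "i > 0" "j > 0" by auto
  then show ?thesis
  proof cases
    case 1
    then obtain c where a: "a = scale c 1" using degree_zero_scalar ij by blast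
    have "\<xi> a = 0" using ij 1 n by (intro point_derivation_other_degree[of a 0]) auto
    moreover have "\<xi> (a * b) = \<epsilon> a * \<xi> b"
      by (simp only: a scale_mult_left mult_1_left \<xi>.scale counit_scale counit_one mult_1_right)
    ultimately show ?thesis by simp
  next
    case 2
    then obtain c where b: "b = scale c 1" using degree_zero_scalar ij by blast
    have "\<xi> b = 0" using ij 2 n by (intro point_derivation_other_degree[of b 0]) auto
    moreover have "\<xi> (a * b) = \<epsilon> b * \<xi> a"
      by (simp only: b scale_mult_right mult_1_right \<xi>.scale counit_scale counit_one)
    ultimately show ?thesis by simp
  next
    case 3
    then have "\<xi> (a * b) = 0" using \<xi> ij unfolding point_derivation_def by blast
    with 3 ij show ?thesis by (simp add: grade_counit)
  qed
qed

text \<open>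
  Only those terms \<open>a \<otimes> b\<close> of \<open>\<Delta> x\<close> survive in which the contracted factor has degree \<open>n\<close>. In degree \<open>n\<close> itself
  these are the outer terms \<open>1 \<otimes> x\<close> and \<open>x \<otimes> 1\<close>.
\<close>

lemma contract_degree:
  assumes x: "x \<in> B" "x \<in> H m"
  shows "m < n \<Longrightarrow> contract_right \<xi> x = 0" "m < n \<Longrightarrow> contract_left \<xi> x = 0"
    and "n \<le> m \<Longrightarrow> contract_right \<xi> x \<in> B \<inter> H (m - n)" "n \<le> m \<Longrightarrow> contract_left \<xi> x \<in> B \<inter> H (m - n)"
    and "m = n \<Longrightarrow> contract_right \<xi> x = scale (\<xi> x) 1" "m = n \<Longrightarrow> contract_left \<xi> x = scale (\<xi> x) 1"
proof -
  note hom = point_derivation_hom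
  note eqs = contract_right_eq[OF hom] contract_left_eq[OF hom]
  have n: "n > 0" using \<xi> by (simp add: point_derivation_def)
  have BH: "subspace (B \<inter> H i)" for i
    using B grade_subspace by (auto simp: graded_subbialgebra_def subalgebra_def intro: subspace_inter)
  obtain f where f: "Poly_Mapping.keys f \<subseteq> pairs B m" "\<Delta> x = tens_cls scale f"
    using B x unfolding graded_subbialgebra_def tens_span_iff by blast
  {
    assume "m < n"
    have "free_lift scale (\<lambda>(a, b). scale (\<xi> b) a) f \<in> {0}" "free_lift scale (\<lambda>(a, b). scale (\<xi> a) b) f \<in> {0}"
    proof -
      have zero: "\<xi> a = 0 \<and> \<xi> b = 0" if "(a, b) \<in> Poly_Mapping.keys f" for a b
      proof -
        obtain i j where "a \<in> H i" "b \<in> H j" "i + j = m" using \<open>(a, b) \<in> Poly_Mapping.keys f\<close> f(1) by blast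
        with \<open>m < n\<close> show ?thesis using point_derivation_other_degree[of a i] point_derivation_other_degree[of b j] by simp
      qed
      show "free_lift scale (\<lambda>(a, b). scale (\<xi> b) a) f \<in> {0}" "free_lift scale (\<lambda>(a, b). scale (\<xi> a) b) f \<in> {0}"
        by (rule free_lift_in_subspace, simp, use zero in force)+
    qed
    then show "contract_right \<xi> x = 0" "contract_left \<xi> x = 0"
      by (simp_all add: eqs[OF f(2)])
  }
  {
    assume "n \<le> m"
    have terms: "(case p of (a, b) \<Rightarrow> scale (\<xi> b) a) \<in> B \<inter> H (m - n) \<and>
        (case p of (a, b) \<Rightarrow> scale (\<xi> a) b) \<in> B \<inter> H (m - n)"
      if pf: "p \<in> Poly_Mapping.keys f" for p
    proof -
      obtain a b i j where p: "p = (a, b)" "a \<in> B \<inter> H i" "b \<in> B \<inter> H j" "i + j = m" using pf f(1) by blast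
      have "scale (\<xi> b) a \<in> B \<inter> H (m - n)"
      proof (cases "j = n")
        case True
        with p show ?thesis using subspace_scale[OF BH, of a i "\<xi> b"] by auto
      next
        case False
        then have "\<xi> b = 0" using p point_derivation_other_degree by blast
        then show ?thesis using subspace_0[OF BH] by simp
      qed
      moreover have "scale (\<xi> a) b \<in> B \<inter> H (m - n)"
      proof (cases "i = n")
        case True
        with p show ?thesis using subspace_scale[OF BH, of b j "\<xi> a"] by auto
      next
        case False
        then have "\<xi> a = 0" using p point_derivation_other_degree by blast
        then show ?thesis using subspace_0[OF BH] by simp
      qed
      ultimately show ?thesis using p(1) by simp
    qed
    show "contract_right \<xi> x \<in> B \<inter> H (m - n)" "contract_left \<xi> x \<in> B \<inter> H (m - n)"
      unfolding eqs[OF f(2)] by (rule free_lift_in_subspace[OF BH], use terms in blast)+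
  }
  {
    assume m: "m = n"
    obtain g where g: "Poly_Mapping.keys g \<subseteq> positive_pairs B m"
        "\<Delta> x = tens_cls scale (Poly_Mapping.single (1, x) 1 + Poly_Mapping.single (x, 1) 1 + g)"
      using reduced_coproduct[OF B x] m n by blast
    have "free_lift scale (\<lambda>(a, b). scale (\<xi> b) a) g \<in> {0}" "free_lift scale (\<lambda>(a, b). scale (\<xi> a) b) g \<in> {0}"
    proof -
      have zero: "\<xi> a = 0 \<and> \<xi> b = 0" if "(a, b) \<in> Poly_Mapping.keys g" for a b
      proof -
        obtain i j where "a \<in> H i" "b \<in> H j" "i + j = m" "i > 0" "j > 0"
          using \<open>(a, b) \<in> Poly_Mapping.keys g\<close> g(1) by blast
        with m show ?thesis using point_derivation_other_degree[of a i] point_derivation_other_degree[of b j] by simp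
      qed
      show "free_lift scale (\<lambda>(a, b). scale (\<xi> b) a) g \<in> {0}" "free_lift scale (\<lambda>(a, b). scale (\<xi> a) b) g \<in> {0}"
        by (rule free_lift_in_subspace, simp, use zero in force)+
    qed
    moreover have "\<xi> 1 = 0" using n grade_one by (intro point_derivation_other_degree[of 1 0]) auto
    ultimately show "contract_right \<xi> x = scale (\<xi> x) 1" "contract_left \<xi> x = scale (\<xi> x) 1"
      by (simp_all add: eqs[OF g(2)] free_lift_add)
  }
qed

lemma contract_leibniz:
  assumes "x \<in> B" "y \<in> B"
  shows "contract_right \<xi> (x * y) = x * contract_right \<xi> y + contract_right \<xi> x * y"
    and "contract_left \<xi> (x * y) = x * contract_left \<xi> y + contract_left \<xi> x * y"
proof -
  obtain f g where f: "Poly_Mapping.keys f \<subseteq> (\<Union>i. B \<inter> H i) \<times> (\<Union>i. B \<inter> H i)" "\<Delta> x = tens_cls scale f"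
    and g: "Poly_Mapping.keys g \<subseteq> (\<Union>i. B \<inter> H i) \<times> (\<Union>i. B \<inter> H i)" "\<Delta> y = tens_cls scale g"
    using homogeneous_representative[OF B] assms by meson
  note hom = point_derivation_hom
  show "contract_right \<xi> (x * y) = x * contract_right \<xi> y + contract_right \<xi> x * y"
    unfolding contract_right_def
    by (rule sweedler_derivation[OF bilinear_contract(1)[OF hom] bilinear_contract(1)[OF counit_hom]
        sweedler_counit_right f(2,1) g(2,1)])
      (simp add: point_derivation_mult scale_mult_left scale_mult_right scale_left_distrib mult.commute)
  show "contract_left \<xi> (x * y) = x * contract_left \<xi> y + contract_left \<xi> x * y"
    unfolding contract_left_def
    by (rule sweedler_derivation[OF bilinear_contract(2)[OF hom] bilinear_contract(2)[OF counit_hom]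
        sweedler_counit_left f(2,1) g(2,1)])
      (simp add: point_derivation_mult scale_mult_left scale_mult_right scale_left_distrib mult.commute)
qed

lemma component_contract:
  assumes x: "x \<in> B"
  shows "component m (contract_right \<xi> x) = contract_right \<xi> (component (m + n) x)"
proof -
  interpret D: module_hom scale scale "contract_right \<xi>" by (rule contract_hom(1)[OF point_derivation_hom])
  have Bc: "component j x \<in> B" for j using B x by (simp add: graded_subbialgebra_def)
  obtain l where "x \<in> filt l" using filt_exhaust by blast
  then have xl: "x \<in> filt (l + m + n)" by (rule filt_mono) simp
  have "component m (contract_right \<xi> x) = (\<Sum>j\<le>l + m + n. component m (contract_right \<xi> (component j x)))"
    by (subst filt_sum[OF xl, symmetric]) (simp only: D.sum component.sum)
  also have "\<dots> = (\<Sum>j\<le>l + m + n. if j = m + n then contract_right \<xi> (component j x) else 0)"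
  proof (rule sum.cong)
    fix j
    show "component m (contract_right \<xi> (component j x)) = (if j = m + n then contract_right \<xi> (component j x) else 0)"
    proof (cases "j < n")
      case True
      then show ?thesis using contract_degree(1)[OF Bc component_in] by auto
    next
      case False
      then have "contract_right \<xi> (component j x) \<in> H (j - n)"
        using contract_degree(3)[OF Bc component_in] by auto
      from component_homogeneous[OF this, of m] False show ?thesis by auto
    qed
  qed simp
  also have "\<dots> = contract_right \<xi> (component (m + n) x)" by simp
  finally show ?thesis .
qed

lemma contract_closed:
  assumes x: "x \<in> B"
  shows "contract_right \<xi> x \<in> B"
proof -
  interpret D: module_hom scale scale "contract_right \<xi>" by (rule contract_hom(1)[OF point_derivation_hom])
  have BS: "subspace B" using B by (simp add: graded_subbialgebra_def subalgebra_def)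
  have Bc: "component j x \<in> B" for j using B x by (simp add: graded_subbialgebra_def)
  have "contract_right \<xi> (component j x) \<in> B" for j
    using contract_degree(1,3)[OF Bc component_in, of j] subspace_0[OF BS] by (cases "j < n") auto
  then have "(\<Sum>j | component j x \<noteq> 0. contract_right \<xi> (component j x)) \<in> B"
    by (intro subspace_sum[OF BS])
  then show ?thesis by (subst sum_components) (simp only: D.sum)
qed

lemma contract_filt:
  assumes "x \<in> B" "x \<in> filt m"
  shows "contract_right \<xi> x \<in> filt (m - n)" "m < n \<Longrightarrow> contract_right \<xi> x = 0"
proof -
  show "contract_right \<xi> x \<in> filt (m - n)"
    using assms module_hom.zero[OF contract_hom(1)[OF point_derivation_hom]]
    by (simp add: filt_def component_contract)
  assume "m < n"
  then have "component j (contract_right \<xi> x) = 0" for j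
    using assms module_hom.zero[OF contract_hom(1)[OF point_derivation_hom]]
    by (simp add: filt_def component_contract)
  then show "contract_right \<xi> x = 0"
    using sum_components[of "contract_right \<xi> x"] by simp
qed

lemma funpow_contract_filt:
  assumes "x \<in> B" "x \<in> filt m"
  shows "(contract_right \<xi> ^^ k) x \<in> B \<and> (contract_right \<xi> ^^ k) x \<in> filt (m - k * n) \<and>
    (m < k * n \<longrightarrow> (contract_right \<xi> ^^ k) x = 0)"
proof (induction k)
  case (Suc k)
  let ?y = "(contract_right \<xi> ^^ k) x"
  have "contract_right \<xi> ?y \<in> filt (m - k * n - n)" "m - k * n < n \<Longrightarrow> contract_right \<xi> ?y = 0"
    using contract_filt[of ?y "m - k * n"] Suc by auto
  moreover have "contract_right \<xi> ?y \<in> B" using contract_closed Suc by auto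
  moreover have "m < k * n \<Longrightarrow> contract_right \<xi> ?y = 0"
    using Suc module_hom.zero[OF contract_hom(1)[OF point_derivation_hom]] by simp
  moreover have "m < Suc k * n \<Longrightarrow> m < k * n \<or> m - k * n < n" by auto
  moreover have "m - k * n - n = m - Suc k * n" by simp
  ultimately show ?case by (metis comp_apply funpow.simps(2))
qed (use assms in auto)

text \<open>
  If no generator has degree above \<open>n\<close>, the left and the right contraction agree: both are derivations, in
  degrees below \<open>n\<close> both vanish, and in degree \<open>n\<close> both send \<open>x\<close> to \<open>\<xi> x\<close>.
\<close>

lemma contract_left_eq_right:
  assumes top: "\<And>m. m \<in> generator_degrees B \<Longrightarrow> m \<le> n" and x: "x \<in> B"
  shows "contract_left \<xi> x = contract_right \<xi> x"
proof -
  interpret R: module_hom scale scale "contract_right \<xi>" by (rule contract_hom(1)[OF point_derivation_hom])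
  interpret L: module_hom scale scale "contract_left \<xi>" by (rule contract_hom(2)[OF point_derivation_hom])
  have hom: "contract_left \<xi> x = contract_right \<xi> x" if "x \<in> B" "x \<in> H m" for x m
    using that
  proof (induction m arbitrary: x rule: less_induct)
    case (less m)
    consider "m < n" | "m = n" | "n < m" by linarith
    then show ?case
    proof cases
      case 3
      \<comment> \<open>Above the top degree all elements are sums of products of elements of lower degree.\<close>
      then have "m \<notin> generator_degrees B" using top by force
      with 3 less.prems have "x \<in> decomposables B m" by (auto simp: generator_degrees_def)
      then show ?thesis
        unfolding decomposables_def
      proof (induction rule: span_induct_alt)
        case (step c u y)
        then obtain a b i j where u: "u = a * b" "a \<in> B" "a \<in> H i" "b \<in> B" "b \<in> H j" "i < m" "j < m" by force
        have "contract_left \<xi> u = contract_right \<xi> u"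
          using less.IH u by (simp add: contract_leibniz)
        with step show ?case by (simp add: L.add R.add L.scale R.scale)
      qed simp
    qed (use contract_degree[OF less.prems] in auto)
  qed
  show ?thesis
    using hom[OF _ component_in] B x
    by (subst (1 2) sum_components) (auto simp: L.sum R.sum graded_subbialgebra_def intro!: sum.cong)
qed

end

text \<open>
  A nonzero element of minimal positive degree cannot be a sum of products of elements of smaller
  positive degree.
\<close>

lemma scalars_if_no_generators:
  assumes B: "graded_subbialgebra B" and none: "generator_degrees B = {}"
  shows "B = scalars scale"
proof -
  have hom: "x = 0" if "x \<in> B" "x \<in> H m" "m > 0" for x m
    using that
  proof (induction m arbitrary: x rule: less_induct)
    case (less m)
    then have "x \<in> decomposables B m" using none unfolding generator_degrees_def by blast
    then show ?case
      unfolding decomposables_def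
    proof (induction rule: span_induct_alt)
      case (step c u y)
      then obtain a b i j where "u = a * b" "a \<in> B" "a \<in> H i" "i < m" "i > 0" by force
      then have "a = 0" using less.IH[of i a] by simp
      with \<open>u = a * b\<close> step show ?case by simp
    qed simp
  qed
  have "x \<in> scalars scale" if "x \<in> B" for x
  proof -
    have "component j x = 0" if "j \<noteq> 0" for j
      using hom[of "component j x" j] that \<open>x \<in> B\<close> B component_in by (auto simp: graded_subbialgebra_def)
    then have "x = component 0 x" using sum_components_superset[of "{0}" x] by simp
    then show ?thesis using degree_zero_scalar[OF component_in[of 0 x]] by (auto simp: scalars_def)
  qed
  moreover have "scalars scale \<subseteq> B"
    using B by (auto simp: scalars_def graded_subbialgebra_def subalgebra_def intro: subspace_scale)
  ultimately show ?thesis by blast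
qed

end


section \<open>Splitting off a generator of top degree\<close>

text \<open>
  If \<open>\<phi> \<otimes> \<psi>\<close> sends the representative \<open>f\<close> to a relation, then every bilinear map kills the result, by the
  universal property.
\<close>

lemma (in k_algebra) bilinear_kills_tprod_zero:
  assumes 0: "free_lift free_scale (\<lambda>(a, b). tprod (\<phi> a) (\<psi> b)) f = 0"
    and \<beta>: "bilinear_map scale free_scale \<beta>"
  shows "free_lift free_scale (\<lambda>(a, b). \<beta> (\<phi> a) (\<psi> b)) f = 0"
proof -
  let ?h = "free_lift free_scale (\<lambda>(a, b). Poly_Mapping.single (\<phi> a, \<psi> b) 1) f"
  have lift: "free_lift free_scale (\<lambda>(a, b). \<gamma> a b) ?h = free_lift free_scale (\<lambda>(a, b). \<gamma> (\<phi> a) (\<psi> b)) f"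
    for \<gamma> :: "'a \<Rightarrow> 'a \<Rightarrow> 'x \<Rightarrow>\<^sub>0 'k"
    by (simp add: free.free_lift_free_lift case_prod_unfold)
  have "tval ?h = tval 0"
    using 0 by (simp add: free.free_lift_free_lift case_prod_unfold)
  then have "tens_cls scale ?h = tens_cls scale 0" by (simp add: tens_cls_eq_iff_tval)
  from free.free_lift_bilinear_cong[OF \<beta> this] show ?thesis by (simp add: lift)
qed

context derivation_with_slice
begin

text \<open>
  What \<open>exp (- z D)\<close> adds to an element depends on the derivative of that element only
  (\<open>constant_part_eq\<close>). So \<open>id \<otimes> constant_part\<close> fixes every tensor that \<open>id \<otimes> D\<close> annihilates.
\<close>

definition correction :: "nat \<Rightarrow> 'a \<Rightarrow> 'a" where
  "correction m y = (\<Sum>k<m. scale ((-1) ^ Suc k / fact (Suc k)) ((D ^^ k) y * z ^ Suc k))"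

lemma constant_part_eq: "constant_part m x = x + correction m (D x)"
proof -
  have "constant_part m x = (\<Sum>k<Suc m. scale ((-1) ^ k / fact k) ((D ^^ k) x * z ^ k))"
    by (simp add: constant_part_def lessThan_Suc_atMost)
  also have "\<dots> = x + correction m (D x)"
    unfolding sum.lessThan_Suc_shift correction_def
    by (simp add: funpow_Suc_right del: funpow.simps fact_Suc power_Suc)
  finally show ?thesis .
qed

lemma correction_hom: "module_hom scale scale (correction m)"
proof (rule module_homI)
  interpret Dk: module_hom scale scale "D ^^ k" for k by (rule hom_funpow[OF D_hom])
  show "correction m (x + y) = correction m x + correction m y" for x y
    by (simp only: correction_def Dk.add distrib_right scale_right_distrib sum.distrib)
  show "correction m (scale c x) = scale c (correction m x)" for c x
    by (simp add: correction_def Dk.scale scale_mult_left scale_sum_right mult.commute del: power_Suc fact_Suc)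
qed

lemma constant_part_hom: "module_hom scale scale (constant_part m)"
  using module_hom.add[OF correction_hom] module_hom.scale[OF correction_hom]
  by (intro module_homI) (simp_all add: constant_part_eq D.add D.scale scale_right_distrib)

end

locale connected_graded_hopf_algebra_char_0 = connected_graded_hopf_algebra scale \<Delta> \<epsilon> S H
  for scale :: "'k::field_char_0 \<Rightarrow> 'h::ring_1 \<Rightarrow> 'h"
    and \<Delta> :: "'h \<Rightarrow> ('h \<times> 'h \<Rightarrow>\<^sub>0 'k) set"
    and \<epsilon> :: "'h \<Rightarrow> 'k"
    and S :: "'h \<Rightarrow> 'h"
    and H :: "nat \<Rightarrow> 'h set"
begin

lemma slice_of_point_derivation:
  assumes B: "graded_subbialgebra B" and \<xi>: "point_derivation B n \<xi>"
    and z: "z \<in> B \<inter> H n" "\<xi> z = 1"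
  shows "derivation_with_slice scale B (contract_right \<xi>) z"
proof (intro derivation_with_slice.intro derivation_with_slice_axioms.intro k_algebra_axioms)
  show "subalgebra scale B" using B by (simp add: graded_subbialgebra_def)
  show "module_hom scale scale (contract_right \<xi>)"
    by (rule contract_hom[OF point_derivation_hom[OF B \<xi>]])
  show "contract_right \<xi> x \<in> B" if "x \<in> B" for x using contract_closed[OF B \<xi> that] .
  show "contract_right \<xi> (x * y) = x * contract_right \<xi> y + contract_right \<xi> x * y"
    if "x \<in> B" "y \<in> B" for x y using contract_leibniz(1)[OF B \<xi> that] .
  show "z \<in> B" using z by simp
  show "contract_right \<xi> z = 1" using contract_degree(5)[OF B \<xi>, of z n] z by simp
qed

lemma funpow_contract_degree:
  assumes B: "graded_subbialgebra B" and \<xi>: "point_derivation B n \<xi>" and x: "x \<in> B" "x \<in> H i"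
    and "k * n \<le> i"
  shows "(contract_right \<xi> ^^ k) x \<in> B \<inter> H (i - k * n)"
  using \<open>k * n \<le> i\<close>
proof (induction k)
  case (Suc k)
  then have y: "(contract_right \<xi> ^^ k) x \<in> B" "(contract_right \<xi> ^^ k) x \<in> H (i - k * n)" by auto
  have "contract_right \<xi> ((contract_right \<xi> ^^ k) x) \<in> B \<inter> H (i - k * n - n)"
    using Suc.prems by (intro contract_degree(3)[OF B \<xi> y]) simp
  moreover have "i - k * n - n = i - Suc k * n" by simp
  ultimately show ?case by (metis comp_apply funpow.simps(2))
qed (use x in simp)

text \<open>
  For a constant \<open>x\<close>, both \<open>id \<otimes> D\<close> and \<open>D \<otimes> id\<close> annihilate \<open>\<Delta> x\<close>: the former by coassociativity, the latter
  because the left contraction equals \<open>D\<close>. Hence the projection \<open>P\<close> onto constants satisfies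
  \<open>(P \<otimes> P) (\<Delta> x) = \<Delta> x\<close>. Since \<open>P\<close> preserves degrees, this shows that \<open>\<Delta> x\<close> is a sum of tensors of
  homogeneous constants.
\<close>

lemma graded_subbialgebra_constants:
  assumes B: "graded_subbialgebra B" and \<xi>: "point_derivation B n \<xi>"
    and z: "z \<in> B \<inter> H n" "\<xi> z = 1"
    and top: "\<And>m. m \<in> generator_degrees B \<Longrightarrow> m \<le> n"
  shows "graded_subbialgebra {x \<in> B. contract_right \<xi> x = 0}"
proof -
  interpret derivation_with_slice scale B "contract_right \<xi>" z
    by (rule slice_of_point_derivation[OF B \<xi> z])
  have n: "n > 0" using \<xi> by (simp add: point_derivation_def)
  note hom = point_derivation_hom[OF B \<xi>]
  have "component m x \<in> constants" if x: "x \<in> constants" for x m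
  proof -
    have xB: "x \<in> B" "component m x \<in> B" using B x by (auto simp: graded_subbialgebra_def)
    have "contract_right \<xi> (component m x) = 0"
    proof (cases "m < n")
      case True
      then show ?thesis using contract_degree(1)[OF B \<xi> xB(2) component_in] by simp
    next
      case False
      then show ?thesis using component_contract[OF B \<xi> xB(1), of "m - n"] x by simp
    qed
    with xB show ?thesis by simp
  qed
  moreover have "\<Delta> x \<in> tens_span scale (pairs constants m)" if x: "x \<in> constants \<inter> H m" for x m
  proof -
    interpret cop: module_hom scale free_scale cop by (rule cop_hom)
    have xB: "x \<in> B" "x \<in> H m" "contract_right \<xi> x = 0" using x by auto
    obtain f where f: "Poly_Mapping.keys f \<subseteq> pairs B m" "\<Delta> x = tens_cls scale f"
      using B xB unfolding graded_subbialgebra_def tens_span_iff by blast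
    have right: "free_lift free_scale (\<lambda>(a, b). tprod a (contract_right \<xi> b)) f = 0"
    proof -
      have "bilinear_map scale free_scale (\<lambda>a b. tprod a (contract_right \<xi> b))"
        by (rule bilinear_mapI) (simp_all add: tprod_simps D.add D.scale)
      from sweedler_eq[OF free.vector_space_axioms this f(2)]
      show ?thesis using cop_contract_right[OF hom, of x] xB(3) by simp
    qed
    have left: "free_lift free_scale (\<lambda>(a, b). tprod (contract_right \<xi> a) b) f = 0"
    proof -
      interpret L: module_hom scale scale "contract_left \<xi>" by (rule contract_hom[OF hom])
      have "bilinear_map scale free_scale (\<lambda>a b. tprod (contract_left \<xi> a) b)"
        by (rule bilinear_mapI) (simp_all add: tprod_simps L.add L.scale)
      from sweedler_eq[OF free.vector_space_axioms this f(2)]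
      have "free_lift free_scale (\<lambda>(a, b). tprod (contract_left \<xi> a) b) f = 0"
        using cop_contract_left[OF hom, of x] contract_left_eq_right[OF B \<xi> top xB(1)] xB(3) by simp
      moreover have "free_lift free_scale (\<lambda>(a, b). tprod (contract_left \<xi> a) b) f =
          free_lift free_scale (\<lambda>(a, b). tprod (contract_right \<xi> a) b) f"
      proof (rule free.free_lift_cong)
        fix p assume "p \<in> Poly_Mapping.keys f"
        then obtain a b where "p = (a, b)" "a \<in> B" using f(1) by blast
        then show "(case p of (a, b) \<Rightarrow> tprod (contract_left \<xi> a) b) =
            (case p of (a, b) \<Rightarrow> tprod (contract_right \<xi> a) b)"
          using contract_left_eq_right[OF B \<xi> top] by simp
      qed
      ultimately show ?thesis by simp
    qed
    let ?P = "constant_part m" and ?Q = "correction m"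
    interpret P: module_hom scale scale ?P by (rule constant_part_hom)
    interpret Q: module_hom scale scale ?Q by (rule correction_hom)
    have "free_lift free_scale (\<lambda>(a, b). tprod a (?Q (contract_right \<xi> b))) f = 0"
      by (rule bilinear_kills_tprod_zero[OF right])
        (rule bilinear_mapI; simp add: tprod_simps Q.add Q.scale)
    \<comment> \<open>First \<open>id \<otimes> P\<close> fixes the tensor, then \<open>P \<otimes> P\<close> does.\<close>
    then have 1: "free_lift free_scale (\<lambda>(a, b). tprod a (?P b)) f = tval f"
      by (simp add: constant_part_eq tprod_simps case_prod_unfold free.free_lift_fun_add)
    have "free_lift free_scale (\<lambda>(a, b). tprod (?Q (contract_right \<xi> a)) (?P b)) f = 0"
      by (rule bilinear_kills_tprod_zero[OF left, of "\<lambda>a b. tprod (?Q a) (?P b)"])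
        (rule bilinear_mapI; simp add: tprod_simps Q.add Q.scale P.add P.scale)
    moreover have "tprod (?P a) (?P b) = tprod a (?P b) + tprod (?Q (contract_right \<xi> a)) (?P b)" for a b
      by (subst constant_part_eq) (simp add: tprod_simps)
    ultimately have 2: "free_lift free_scale (\<lambda>(a, b). tprod (?P a) (?P b)) f = tval f"
      using 1 by (simp add: case_prod_unfold free.free_lift_fun_add)
    let ?f = "free_lift free_scale (\<lambda>(a, b). Poly_Mapping.single (?P a, ?P b) (1::'k)) f"
    have "tval ?f = tval f" using 2 by (simp add: free.free_lift_free_lift case_prod_unfold)
    then have "\<Delta> x = tens_cls scale ?f" using f(2) by (simp add: tens_cls_eq_iff_tval)
    moreover have "?f \<in> free.span {Poly_Mapping.single (a, b) 1 | a b. (a, b) \<in> pairs constants m}"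
    proof (rule free.free_lift_in_subspace)
      have P: "?P a \<in> constants \<inter> H i" if a: "a \<in> B" "a \<in> H i" "i \<le> m" for a i
      proof -
        have zero: "i < k * n \<Longrightarrow> (contract_right \<xi> ^^ k) a = 0" for k
          using funpow_contract_filt[OF B \<xi> a(1) homogeneous_in_filt[OF a(2)], of k] by simp
        have "i < Suc m * 1" using \<open>i \<le> m\<close> by simp
        also have "\<dots> \<le> Suc m * n" using n by (intro mult_le_mono2) simp
        finally have "i < Suc m * n" .
        then have "?P a \<in> constants" by (intro constant_part_in_constants a zero)
        moreover have "(contract_right \<xi> ^^ k) a * z ^ k \<in> H i" for k
        proof (cases "k * n \<le> i")
          case True
          then have "(contract_right \<xi> ^^ k) a * z ^ k \<in> H ((i - k * n) + k * n)"
            using funpow_contract_degree[OF B \<xi> a(1,2) True] z(1) by (intro grade_mult grade_power) auto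
          with True show ?thesis by simp
        qed (use zero grade_subspace subspace_0 in auto)
        then have "?P a \<in> H i"
          unfolding constant_part_def by (intro subspace_sum subspace_scale grade_subspace)
        ultimately show ?thesis by blast
      qed
      fix p assume "p \<in> Poly_Mapping.keys f"
      then obtain a b i j where p: "p = (a, b)" "a \<in> B" "a \<in> H i" "b \<in> B" "b \<in> H j" "i + j = m"
        using f(1) by blast
      then have "?P a \<in> constants \<inter> H i" "?P b \<in> constants \<inter> H j" using P by auto
      then have "(?P a, ?P b) \<in> pairs constants m" using p(6) by blast
      then show "(case p of (a, b) \<Rightarrow> Poly_Mapping.single (?P a, ?P b) 1)
          \<in> free.span {Poly_Mapping.single (a, b) 1 | a b. (a, b) \<in> pairs constants m}"
        unfolding p(1) prod.case by (intro free.span_base) blast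
    qed simp
    ultimately show ?thesis unfolding tens_span_def by blast
  qed
  ultimately show ?thesis
    using subalgebra_constants unfolding graded_subbialgebra_def by blast
qed

text \<open>
  One step \<open>B = A[z; \<delta>]\<close> of the chain. The last clause refines the expansion in powers of \<open>z\<close> by
  control of degrees, which is what the upper bound for the dimension needs.
\<close>

definition ore_step :: "'h set \<Rightarrow> nat \<Rightarrow> 'h \<Rightarrow> 'h set \<Rightarrow> bool" where
  "ore_step A n z B \<longleftrightarrow> n > 0 \<and> z \<in> H n \<and> z \<noteq> 0 \<and> free_over A z \<and>
     differential_ore_extension scale A z (\<lambda>a. z * a - a * z) B \<and>
     (\<exists>w \<in> tens_span scale (positive_pairs A n).
        \<Delta> z = tens_add scale (tens_add scale (tens_pure scale 1 z) (tens_pure scale z 1)) w) \<and>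
     (\<forall>m. \<forall>b\<in>B \<inter> filt m. \<exists>c. (\<forall>i. c i \<in> A \<inter> filt m) \<and> b = (\<Sum>i\<le>m. c i * z ^ i))"

lemma ore_step_expansion:
  assumes "ore_step A n z B" "b \<in> B" "b \<in> filt m"
  shows "\<exists>c. (\<forall>i. c i \<in> A \<inter> filt m) \<and> b = (\<Sum>i\<le>m. c i * z ^ i)"
proof -
  have "\<forall>m. \<forall>b\<in>B \<inter> filt m. \<exists>c. (\<forall>i. c i \<in> A \<inter> filt m) \<and> b = (\<Sum>i\<le>m. c i * z ^ i)"
    using assms(1) unfolding ore_step_def by (elim conjE)
  with assms(2,3) show ?thesis by blast
qed

text \<open>
  The generator \<open>z\<close> is taken in the highest degree \<open>n\<close>. The constants contain all elements of \<open>B\<close> of degree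
  less than \<open>n\<close>, so the middle terms of \<open>\<Delta> z\<close> automatically consist of constants.
\<close>

lemma ore_step_exists:
  assumes B: "graded_subbialgebra B" and gen: "generator_degrees B \<noteq> {}" "finite (generator_degrees B)"
  shows "\<exists>A n z. graded_subbialgebra A \<and> ore_step A n z B"
proof -
  define n where "n = Max (generator_degrees B)"
  have n: "n \<in> generator_degrees B" "\<And>m. m \<in> generator_degrees B \<Longrightarrow> m \<le> n"
    using gen by (auto simp: n_def)
  obtain z \<xi> where z: "z \<in> B \<inter> H n" "\<xi> z = 1" and \<xi>: "point_derivation B n \<xi>"
    using point_derivation_exists[OF n(1)] by blast
  interpret derivation_with_slice scale B "contract_right \<xi>" z
    by (rule slice_of_point_derivation[OF B \<xi> z])
  have n0: "n > 0" using \<xi> by (simp add: point_derivation_def)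
  have zero: "(contract_right \<xi> ^^ Suc m) b = 0" if "b \<in> B" "b \<in> filt m" for b m
  proof -
    have "m < Suc m * 1" by simp
    also have "\<dots> \<le> Suc m * n" using n0 by (intro mult_le_mono2) simp
    finally have "m < Suc m * n" .
    then show ?thesis using funpow_contract_filt[OF B \<xi> that, of "Suc m"] by blast
  qed
  have "\<exists>k. (contract_right \<xi> ^^ k) b = 0" if "b \<in> B" for b
    using zero[OF that] filt_exhaust by blast
  note ore = ore_extension_constants[OF this]
  have expansion: "\<exists>c. (\<forall>i. c i \<in> constants \<inter> filt m) \<and> b = (\<Sum>i\<le>m. c i * z ^ i)"
    if b: "b \<in> B \<inter> filt m" for b m
  proof -
    have X: "subspace (B \<inter> filt m)" using B_simps(1) subspace_filt by (rule subspace_inter)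
    have cl: "(contract_right \<xi> ^^ k) y \<in> B \<inter> filt m" if "y \<in> B \<inter> filt m" for y k
      using funpow_contract_filt[OF B \<xi>, of y m k] that filt_mono[of _ "m - k * n" m] by auto
    have clz: "(contract_right \<xi> ^^ k) y * z ^ k \<in> B \<inter> filt m" if y: "y \<in> B \<inter> filt m" for y k
    proof (cases "m < k * n")
      case True
      then have "(contract_right \<xi> ^^ k) y = 0" using funpow_contract_filt[OF B \<xi>, of y m k] y by auto
      then show ?thesis using subspace_0[OF X] by simp
    next
      case False
      have "(contract_right \<xi> ^^ k) y \<in> filt (m - k * n)" "z ^ k \<in> filt (k * n)"
        using funpow_contract_filt[OF B \<xi>, of y m k] y z(1) grade_power homogeneous_in_filt by auto
      then have "(contract_right \<xi> ^^ k) y * z ^ k \<in> filt ((m - k * n) + k * n)"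
        by (rule filt_mult)
      then have "(contract_right \<xi> ^^ k) y * z ^ k \<in> filt m" using False by simp
      moreover have "(contract_right \<xi> ^^ k) y * z ^ k \<in> B"
        using y slice_mem by (intro B_simps(3,8) D_funpow_closed) auto
      ultimately show ?thesis by blast
    qed
    obtain c where "\<forall>i. c i \<in> (B \<inter> filt m) \<inter> constants" "b = (\<Sum>i<Suc m. c i * z ^ i)"
      using slice_expansion[OF X _ cl clz b zero] b by auto
    then show ?thesis unfolding lessThan_Suc_atMost by (intro exI[of _ c]) auto
  qed
  obtain g where g: "Poly_Mapping.keys g \<subseteq> positive_pairs B n"
    "\<Delta> z = tens_cls scale (Poly_Mapping.single (1, z) 1 + Poly_Mapping.single (z, 1) 1 + g)"
    using reduced_coproduct[OF B, of z n] z n0 by blast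
  have low: "x \<in> constants" if "x \<in> B" "x \<in> H j" "j < n" for x j
    using contract_degree(1)[OF B \<xi> that] that(1) by simp
  have "positive_pairs B n \<subseteq> positive_pairs constants n"
  proof
    fix p assume "p \<in> positive_pairs B n"
    then obtain a b i j where p: "p = (a, b)" "a \<in> B" "a \<in> H i" "b \<in> B" "b \<in> H j"
      "i > 0" "j > 0" "i + j = n" by blast
    then have "a \<in> constants" "b \<in> constants" using low[of a i] low[of b j] by auto
    with p have "(a, b) \<in> (constants \<inter> H i) \<times> (constants \<inter> H j)" by simp
    with p(1,6-8) show "p \<in> positive_pairs constants n" by blast
  qed
  then have "Poly_Mapping.keys g \<subseteq> positive_pairs constants n" using g(1) by (rule order_trans[rotated])
  then have "tens_cls scale g \<in> tens_span scale (positive_pairs constants n)"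
    unfolding tens_span_iff by (intro exI[of _ g] conjI refl)
  moreover have "\<Delta> z = tens_add scale (tens_add scale (tens_pure scale 1 z) (tens_pure scale z 1)) (tens_cls scale g)"
    by (simp add: g(2) tens_pure_def tens_add_cls)
  moreover have "z \<noteq> 0"
    using D_slice one_neq_zero by auto
  ultimately have "ore_step constants n z B"
    unfolding ore_step_def
  proof (intro conjI allI ballI bexI)
    show "\<exists>c. (\<forall>i. c i \<in> constants \<inter> filt m) \<and> b = (\<Sum>i\<le>m. c i * z ^ i)"
      if "b \<in> B \<inter> filt m" for m b by (rule expansion[OF that])
  qed (use n0 z ore free_over_constants in simp_all)
  then show ?thesis using graded_subbialgebra_constants[OF B \<xi> z n(2)] by blast
qed


section \<open>Finitely many generators, and the chain of extensions\<close>

text \<open>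
  Here the degrees of generators may be unbounded. Each \<open>\<xi>\<^sub>i\<close> gives a derivation with
  slice \<open>z\<^sub>i\<close>, and it lowers the degree by \<open>n\<^sub>i\<close>, so it kills \<open>z\<^sub>j\<close> for all \<open>j < i\<close>. The kernels serve as the
  witnesses of freeness.
\<close>

lemma generator_degrees_free_tower:
  assumes B: "graded_subbialgebra B"
    and n: "\<And>i. i < p \<Longrightarrow> n i \<in> generator_degrees B" "\<And>i j. j < i \<Longrightarrow> i < p \<Longrightarrow> n j < n i"
  shows "free_tower p B"
proof -
  have "\<forall>i. \<exists>z \<xi>. i < p \<longrightarrow> z \<in> B \<inter> H (n i) \<and> point_derivation B (n i) \<xi> \<and> \<xi> z = 1"
    using point_derivation_exists[OF n(1)] by blast
  then obtain z \<xi> where z: "\<And>i. i < p \<Longrightarrow> z i \<in> B \<inter> H (n i)" "\<And>i. i < p \<Longrightarrow> \<xi> i (z i) = 1"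
    and \<xi>: "\<And>i. i < p \<Longrightarrow> point_derivation B (n i) (\<xi> i)" by metis
  let ?A = "\<lambda>i. {x \<in> B. contract_right (\<xi> i) x = 0}"
  show ?thesis
    unfolding free_tower_def
  proof (intro exI allI impI conjI)
    fix i assume i: "i < p"
    interpret derivation_with_slice scale B "contract_right (\<xi> i)" "z i"
      using i by (intro slice_of_point_derivation[OF B \<xi> z])
    show "subalgebra scale (?A i)" "z i \<in> B" "free_over (?A i) (z i)"
      using subalgebra_constants slice_mem free_over_constants by blast+
    show "z j \<in> ?A i" if "j < i" for j
      using contract_degree(1)[OF B \<xi>[OF i], of "z j" "n j"] z(1)[of j] n(2)[OF that i] that i by auto
  qed
qed

lemma subalgebra_generated: "subalgebra scale (generated_subalgebra scale X)"
  unfolding generated_subalgebra_def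
  by (rule hull_in) (auto simp: subalgebra_def subspace_def)

lemma generated_by_ore_step:
  assumes step: "ore_step (generated_subalgebra scale Z) n z B"
  shows "generated_subalgebra scale (insert z Z) = B"
proof -
  let ?A = "generated_subalgebra scale Z" and ?G = "generated_subalgebra scale (insert z Z)"
  have B: "subalgebra scale B" "?A \<subseteq> B" "z \<in> B"
    using step by (auto simp: ore_step_def ore_extension_def)
  note G_simps = subalgebra_simps[OF subalgebra_generated[of "insert z Z"]]
  have "Z \<subseteq> ?A" "insert z Z \<subseteq> ?G" unfolding generated_subalgebra_def by (rule hull_subset)+
  then have "?G \<subseteq> B"
    using B unfolding generated_subalgebra_def[of _ "insert z Z"] by (intro hull_minimal) auto
  moreover have "?A \<subseteq> ?G" unfolding generated_subalgebra_def by (rule hull_mono) blast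
  have "b \<in> ?G" if b: "b \<in> B" for b
  proof -
    obtain m where "b \<in> filt m" using filt_exhaust by blast
    from ore_step_expansion[OF step b this]
    obtain c where "(\<forall>i. c i \<in> ?A \<inter> filt m) \<and> b = (\<Sum>i\<le>m. c i * z ^ i)" ..
    then show ?thesis
      using \<open>?A \<subseteq> ?G\<close> \<open>insert z Z \<subseteq> ?G\<close> by (auto intro!: subspace_sum[OF G_simps(1)] G_simps(3,8))
  qed
  ultimately show ?thesis by blast
qed

text \<open>
  In filtration degree \<open>m\<close> only the powers of \<open>z\<close> up to \<open>m\<close> occur, since \<open>z\<close> has positive degree.
\<close>

lemma ore_step_growth:
  assumes step: "ore_step A n z B" and X: "finite X" "card X \<le> (m + 1) ^ d" "A \<inter> filt m \<subseteq> span X"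
  shows "\<exists>Y. finite Y \<and> card Y \<le> (m + 1) ^ Suc d \<and> B \<inter> filt m \<subseteq> span Y"
proof (intro exI conjI subsetI)
  let ?Y = "(\<lambda>(x, i). x * z ^ i) ` (X \<times> {..m})"
  show "finite ?Y" using X by simp
  have "card ?Y \<le> card X * (m + 1)"
    using card_image_le[of "X \<times> {..m}" "\<lambda>(x, i). x * z ^ i"] X(1) by (simp add: card_cartesian_product)
  also have "\<dots> \<le> (m + 1) ^ d * (m + 1)" using X(2) by (rule mult_le_mono1)
  finally show "card ?Y \<le> (m + 1) ^ Suc d" by (simp add: mult.commute)
  fix b assume "b \<in> B \<inter> filt m"
  then have "b \<in> B" "b \<in> filt m" by auto
  from ore_step_expansion[OF step this]
  obtain c where "(\<forall>i. c i \<in> A \<inter> filt m) \<and> b = (\<Sum>i\<le>m. c i * z ^ i)" ..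
  then have c: "\<And>i. c i \<in> A \<inter> filt m" "b = (\<Sum>i\<le>m. c i * z ^ i)" by auto
  have "c i * z ^ i \<in> span ?Y" if "i \<le> m" for i
  proof (rule span_mult)
    show "c i \<in> span X" using c(1) X(3) by blast
    show "z ^ i \<in> span {z ^ i}" by (rule span_base) simp
  qed (use that in auto)
  then show "b \<in> span ?Y" unfolding c(2) by (intro span_sum) simp
qed

text \<open>
  The subalgebras of the chain are recorded through their generators, so that extending a chain
  at the top does not disturb the lower ones.
\<close>

definition ore_chain :: "nat \<Rightarrow> (nat \<Rightarrow> 'h) \<Rightarrow> (nat \<Rightarrow> nat) \<Rightarrow> 'h set \<Rightarrow> bool" where
  "ore_chain d z deg B \<longleftrightarrow> generated_subalgebra scale (z ` {1..d}) = B \<and>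
     (\<forall>i\<le>d. graded_subbialgebra (generated_subalgebra scale (z ` {1..i}))) \<and>
     (\<forall>i<d. ore_step (generated_subalgebra scale (z ` {1..i})) (deg (Suc i)) (z (Suc i))
        (generated_subalgebra scale (z ` {1..Suc i})))"

lemma ore_chain_Suc:
  assumes chain: "ore_chain d z deg A" and step: "ore_step A n y B" and B: "graded_subbialgebra B"
  shows "ore_chain (Suc d) (z(Suc d := y)) (deg(Suc d := n)) B"
proof -
  let ?z = "z(Suc d := y)" and ?deg = "deg(Suc d := n)"
  have old: "?z ` {1..i} = z ` {1..i}" if "i \<le> d" for i using that by auto
  have A: "generated_subalgebra scale (z ` {1..d}) = A" using chain by (simp add: ore_chain_def)
  have "?z ` {1..Suc d} = insert y (z ` {1..d})"
    using old[of d] by (auto simp: atLeastAtMostSuc_conv)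
  then have new: "generated_subalgebra scale (?z ` {1..Suc d}) = B"
    using generated_by_ore_step[of "z ` {1..d}" n y B] step by (simp only: A)
  have "graded_subbialgebra (generated_subalgebra scale (?z ` {1..i}))" if "i \<le> Suc d" for i
  proof (cases "i = Suc d")
    case True
    then show ?thesis using B by (simp only: new)
  next
    case False
    then have "i \<le> d" using that by simp
    then show ?thesis using chain by (simp only: old) (simp add: ore_chain_def)
  qed
  moreover have "ore_step (generated_subalgebra scale (?z ` {1..i})) (?deg (Suc i)) (?z (Suc i))
        (generated_subalgebra scale (?z ` {1..Suc i}))" if "i < Suc d" for i
  proof (cases "i = d")
    case True
    then show ?thesis using step by (simp only: True new old[OF order_refl] A) simp
  next
    case False
    then have "i < d" using that by simp
    then show ?thesis using chain by (simp only: old[of i] old[of "Suc i"] Suc_le_eq less_imp_le) (simp add: ore_chain_def)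
  qed
  ultimately show ?thesis unfolding ore_chain_def using new by blast
qed

text \<open>
  Induction on the bound \<open>N\<close> for the length of free towers. A tower in the constants \<open>A\<close> extends by \<open>z\<close> to one
  in \<open>B\<close>, so the bound for \<open>A\<close> is smaller; and infinitely many generator degrees would give arbitrarily
  long towers.
\<close>

lemma ore_chain_exists:
  assumes "graded_subbialgebra B" "\<And>p. free_tower p B \<Longrightarrow> p \<le> N"
  shows "\<exists>d z deg. ore_chain d z deg B \<and> free_tower d B \<and>
    (\<forall>m. \<exists>X. finite X \<and> card X \<le> (m + 1) ^ d \<and> B \<inter> filt m \<subseteq> span X)"
  using assms
proof (induction N arbitrary: B rule: less_induct)
  case (less N)
  note B = less.prems(1)
  have fin: "finite (generator_degrees B)"
  proof (rule ccontr)
    assume inf: "infinite (generator_degrees B)"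
    \<comment> \<open>The first \<open>N + 1\<close> generator degrees, in increasing order.\<close>
    have "free_tower (Suc N) B"
      using inf by (intro generator_degrees_free_tower[OF B, of _ "enumerate (generator_degrees B)"])
        (auto intro: enumerate_in_set enumerate_mono)
    with less.prems(2)[of "Suc N"] show False by simp
  qed
  show ?case
  proof (cases "generator_degrees B = {}")
    case True
    then have BS: "B = scalars scale" by (rule scalars_if_no_generators[OF B])
    have "ore_chain 0 (\<lambda>_. 0) (\<lambda>_. 0) B"
      using B by (simp add: ore_chain_def generated_subalgebra_empty BS)
    moreover have "free_tower 0 B" by (simp add: free_tower_def)
    moreover have "B \<inter> filt m \<subseteq> span {1}" for m
      by (auto simp: BS scalars_def intro: span_scale span_base)
    ultimately show ?thesis
      by (intro exI[of _ 0] exI[of _ "\<lambda>_. 0"] conjI allI exI[of _ "{1}"]) auto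
  next
    case False
    obtain A n y where A: "graded_subbialgebra A" and step: "ore_step A n y B"
      using ore_step_exists[OF B False fin] by blast
    have AB: "A \<subseteq> B" "y \<in> B" "free_over A y" using step by (auto simp: ore_step_def ore_extension_def)
    have tower: "free_tower p A \<Longrightarrow> free_tower (Suc p) B" for p
      using free_tower_Suc[of p A B y] A AB by (simp add: graded_subbialgebra_def)
    have "N \<noteq> 0" using less.prems(2)[OF tower[of 0]] by (auto simp: free_tower_def)
    then have lt: "N - 1 < N" by simp
    have bound: "p \<le> N - 1" if "free_tower p A" for p
      using less.prems(2)[OF tower[OF that]] by simp
    have "\<exists>d z deg. ore_chain d z deg A \<and> free_tower d A \<and>
        (\<forall>m. \<exists>X. finite X \<and> card X \<le> (m + 1) ^ d \<and> A \<inter> filt m \<subseteq> span X)"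
      by (rule less.IH[OF lt A]) (rule bound)
    then obtain d z deg where chain: "ore_chain d z deg A" "free_tower d A"
      "\<forall>m. \<exists>X. finite X \<and> card X \<le> (m + 1) ^ d \<and> A \<inter> filt m \<subseteq> span X"
      by (elim exE conjE) (rule that)
    have "\<forall>m. \<exists>X. finite X \<and> card X \<le> (m + 1) ^ Suc d \<and> B \<inter> filt m \<subseteq> span X"
      using chain(3) ore_step_growth[OF step] by blast
    then show ?thesis
      using ore_chain_Suc[OF chain(1) step B] tower[OF chain(2)] by blast
  qed
qed

text \<open>
  The first step of the chain: left polynomials in \<open>z\<close> with scalar coefficients are the values at \<open>z\<close>
  of polynomials over the base field.
\<close>

lemma polynomial_algebra_over_scalars:
  assumes step: "ore_step (scalars scale) n z B"
  shows "polynomial_algebra scale z B"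
proof -
  let ?ev = "\<lambda>p :: 'k poly. \<Sum>i\<le>degree p. scale (coeff p i) (z ^ i)"
  have ev: "?ev p = (\<Sum>i\<le>N. scale (coeff p i) (z ^ i))" if "degree p \<le> N" for p N
    using that by (intro sum.mono_neutral_left) (auto simp: coeff_eq_0)
  have free: "free_over (scalars scale) z"
    using step unfolding ore_step_def by (elim conjE)
  have "differential_ore_extension scale (scalars scale) z (\<lambda>a. z * a - a * z) B"
    using step unfolding ore_step_def by (elim conjE)
  then have ore: "subalgebra scale B" "z \<in> B" by (simp_all add: ore_extension_def)
  note B_simps = subalgebra_simps[OF ore(1)]
  have "inj ?ev"
  proof (rule injI)
    fix p q :: "'k poly" assume eq: "?ev p = ?ev q"
    let ?N = "max (degree p) (degree q)"
    have "(\<Sum>i\<le>?N. scale (coeff p i - coeff q i) 1 * z ^ i) =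
        (\<Sum>i\<le>?N. scale (coeff p i) (z ^ i)) - (\<Sum>i\<le>?N. scale (coeff q i) (z ^ i))"
      by (simp only: scale_left_diff_distrib left_diff_distrib scale_mult_left mult_1_left sum_subtractf)
    also have "\<dots> = 0" using eq ev[of p ?N] ev[of q ?N] by simp
    finally have zero: "(\<Sum>i\<le>?N. scale (coeff p i - coeff q i) 1 * z ^ i) = 0" .
    have mem: "\<forall>i. scale (coeff p i - coeff q i) 1 \<in> scalars scale" unfolding scalars_def by blast
    have "\<forall>i\<le>?N. scale (coeff p i - coeff q i) (1::'h) = 0"
      by (rule free[unfolded free_over_def, THEN spec[of _ "\<lambda>i. scale (coeff p i - coeff q i) 1"],
            THEN spec[of _ ?N], THEN mp, THEN mp, OF mem zero])
    then have "coeff p i = coeff q i" for i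
      using one_neq_zero by (cases "i \<le> ?N") (auto simp: coeff_eq_0)
    then show "p = q" by (rule poly_eqI)
  qed
  moreover have "?ev p \<in> B" for p using ore B_simps by (intro subspace_sum) auto
  moreover have "b \<in> range ?ev" if b: "b \<in> B" for b
  proof -
    obtain N where "b \<in> filt N" using filt_exhaust by blast
    from ore_step_expansion[OF step b this]
    obtain c where "(\<forall>i. c i \<in> scalars scale \<inter> filt N) \<and> b = (\<Sum>i\<le>N. c i * z ^ i)" ..
    then have c: "\<forall>i. c i \<in> scalars scale" "b = (\<Sum>i\<le>N. c i * z ^ i)" by auto
    have "\<forall>i. \<exists>k. c i = scale k 1" using c(1) by (auto simp: scalars_def)
    then obtain k where k: "\<And>i. c i = scale (k i) 1" by metis
    let ?p = "\<Sum>i\<le>N. monom (k i) i"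
    have "degree ?p \<le> N" by (intro degree_sum_le) (auto intro: order_trans[OF degree_monom_le])
    then have "?ev ?p = (\<Sum>i\<le>N. scale (coeff ?p i) (z ^ i))" by (rule ev)
    also have "\<dots> = (\<Sum>i\<le>N. c i * z ^ i)"
      by (intro sum.cong) (auto simp: coeff_sum k scale_mult_left)
    finally have "?ev ?p = b" by (simp only: c(2))
    then show ?thesis by blast
  qed
  ultimately show ?thesis unfolding polynomial_algebra_def bij_betw_def by blast
qed

end

theorem theoremB:
  fixes scale :: "'k::field_char_0 \<Rightarrow> 'h::ring_1 \<Rightarrow> 'h"
    and \<Delta> :: "'h \<Rightarrow> ('h \<times> 'h \<Rightarrow>\<^sub>0 'k) set"
    and \<epsilon> :: "'h \<Rightarrow> 'k"
    and S :: "'h \<Rightarrow> 'h"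
    and H :: "nat \<Rightarrow> 'h set"
    and gkd :: real
  assumes "connected_graded_hopf_algebra scale \<Delta> \<epsilon> S H"
    and "gk_dim scale = ereal gkd"
  shows "iterated_hopf_ore_extension scale \<Delta> S \<and>
    (\<exists>d :: nat. gkd = real d \<and>
      (\<exists>(z :: nat \<Rightarrow> 'h) (deg :: nat \<Rightarrow> nat) (\<delta> :: nat \<Rightarrow> 'h \<Rightarrow> 'h) (Hle :: nat \<Rightarrow> 'h set).
        (\<forall>r\<in>{1..d}. deg r > 0 \<and> z r \<noteq> 0 \<and> z r \<in> H (deg r)) \<and>
        Hle 0 = scalars scale \<and>
        (\<forall>i\<in>{1..d}. Hle i = generated_subalgebra scale (z ` {1..i})) \<and>
        (d \<ge> 1 \<longrightarrow> polynomial_algebra scale (z 1) (Hle 1)) \<and>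
        (\<forall>i\<in>{2..d}. derivation scale (Hle (i - 1)) (\<delta> i) \<and>
           differential_ore_extension scale (Hle (i - 1)) (z i) (\<delta> i) (Hle i)) \<and>
        Hle d = UNIV \<and>
        (\<forall>r\<in>{1..d}. \<exists>w \<in> tens_span scale
             (\<Union>(i, j)\<in>{(i, j). i > 0 \<and> j > 0 \<and> i + j = deg r}.
                (Hle (r - 1) \<inter> H i) \<times> (Hle (r - 1) \<inter> H j)).
           \<Delta> (z r) = tens_add scale
             (tens_add scale (tens_pure scale 1 (z r)) (tens_pure scale (z r) 1)) w) \<and>
        (\<forall>i\<in>{0..d}. graded_hopf_subalgebra scale \<Delta> S H (Hle i))))"
proof -
  interpret connected_graded_hopf_algebra scale \<Delta> \<epsilon> S H by fact
  interpret connected_graded_hopf_algebra_char_0 scale \<Delta> \<epsilon> S H ..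
  have "p \<le> nat \<lfloor>gkd\<rfloor>" if "free_tower p UNIV" for p
  proof -
    have "real p \<le> gkd" using free_tower_le_gk_dim[OF that one_neq_zero] assms(2) by simp
    then show ?thesis by (simp add: le_nat_floor)
  qed
  from ore_chain_exists[OF graded_subbialgebra_UNIV this]
  obtain d z deg where chain: "ore_chain d z deg UNIV" and tower: "free_tower d UNIV"
    and growth: "\<And>m. \<exists>X. finite X \<and> card X \<le> (m + 1) ^ d \<and> filt m \<subseteq> span X"
    by auto
  \<comment> \<open>The length of the chain is both an upper and, by the tower of its generators, a lower bound.\<close>
  have "gk_dim scale \<le> ereal (real d)"
    by (rule gk_dim_le[OF subspace_filt filt_mono filt_exhaust homogeneous_in_filt[OF grade_one] filt_mult growth])
  then have gkd: "gkd = real d"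
    using free_tower_le_gk_dim[OF tower one_neq_zero] assms(2) by simp
  define Hle where "Hle i = generated_subalgebra scale (z ` {1..i})" for i
  define \<delta> where "\<delta> i = (\<lambda>a. z i * a - a * z i)" for i
  have Hle0: "Hle 0 = scalars scale" by (simp add: Hle_def generated_subalgebra_empty)
  have Hled: "Hle d = UNIV" using chain by (simp add: Hle_def ore_chain_def)
  have sub: "graded_hopf_subalgebra scale \<Delta> S H (Hle i)" if "i \<le> d" for i
    using chain that graded_hopf_subalgebra_if_subbialgebra by (simp add: Hle_def ore_chain_def)
  have step: "ore_step (Hle (r - 1)) (deg r) (z r) (Hle r)" if r: "r \<in> {1..d}" for r
  proof -
    obtain i where "r = Suc i" "i < d" using r by (cases r) auto
    then show ?thesis using chain by (simp add: Hle_def ore_chain_def)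
  qed
  have ore: "differential_ore_extension scale (Hle (r - 1)) (z r) (\<delta> r) (Hle r)" if "r \<in> {1..d}" for r
    using step[OF that] by (simp add: ore_step_def \<delta>_def)
  show ?thesis
  proof (intro conjI exI[of _ d] exI[of _ z] exI[of _ deg] exI[of _ \<delta>] exI[of _ Hle] ballI impI)
    show "iterated_hopf_ore_extension scale \<Delta> S"
      unfolding iterated_hopf_ore_extension_def
    proof (intro exI conjI allI impI)
      show "Hle 0 = scalars scale" "Hle d = UNIV" by (rule Hle0, rule Hled)
      show "hopf_subalgebra scale \<Delta> S (Hle i)" if "i \<le> d" for i
        using sub[OF that] by (simp add: graded_hopf_subalgebra_def)
      show "ore_extension scale (Hle i) (z (Suc i)) (\<lambda>a. a) (\<delta> (Suc i)) (Hle (Suc i))" if "i < d" for i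
        using ore[of "Suc i"] that by simp
    qed
    show "gkd = real d" "Hle 0 = scalars scale" "Hle d = UNIV" by (rule gkd, rule Hle0, rule Hled)
    show "Hle i = generated_subalgebra scale (z ` {1..i})" for i by (rule Hle_def)
    show "polynomial_algebra scale (z 1) (Hle 1)" if "d \<ge> 1"
      using step[of 1] that by (intro polynomial_algebra_over_scalars) (simp add: Hle0)
    fix r
    show "graded_hopf_subalgebra scale \<Delta> S H (Hle r)" if "r \<in> {0..d}" using sub that by simp
    {
      assume "r \<in> {2..d}"
      then have "r \<in> {1..d}" by simp
      from ore[OF this] show "differential_ore_extension scale (Hle (r - 1)) (z r) (\<delta> r) (Hle r)"
        and "derivation scale (Hle (r - 1)) (\<delta> r)"
        by (simp_all add: ore_extension_def)
    }
    {
      assume "r \<in> {1..d}"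
      from step[OF this] show "deg r > 0" "z r \<noteq> 0" "z r \<in> H (deg r)"
        "\<exists>w \<in> tens_span scale (positive_pairs (Hle (r - 1)) (deg r)).
           \<Delta> (z r) = tens_add scale (tens_add scale (tens_pure scale 1 (z r)) (tens_pure scale (z r) 1)) w"
        by (simp_all add: ore_step_def)
    }
  qed
qed

end
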